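(* For all integers $k \geq 3$, $g \geq 3$, and $r \geq 2$, let $W = \operatorname{vdW}(k,r)$ denote the least integer $N$ such that every $r$-colouring of $[N] = \{1,2,\dots,N\}$ yields a monochromatic arithmetic progression of length $k$. Then there exists a set $S \subseteq \mathbb{N}$ such that $$\chi\binom{S}{\mathrm{AP}_k} > r, \qquad \operatorname{girth}\binom{S}{\mathrm{AP}_k} \geq g, \qquad\text{and}\qquad |S| \leq k^{40k^2(k+g)}\, W^{12k(k+g)}.$$
   Context: For $S \subseteq \mathbb{N}$, $\binom{S}{\mathrm{AP}_k}$ denotes the $k$-uniform hypergraph with vertex set $S$ whose edges are the $k$-element subsets of $S$ that form an arithmetic progression of length $k$. The chromatic number $\chi$ of a hypergraph is the least number of colours in a vertex colouring with no monochromatic edge; thus $\chi\binom{S}{\mathrm{AP}_k} > r$ means that every $r$-colouring of $S$ yields a monochromatic $k$-term arithmetic progression. A $k$-uniform hypergraph has girth at least $g$ if, for every integer $h$ with $2 \leq h < g$, any set of $h$ (distinct) edges spans at least $(k-1)h+1$ vertices, i.e. their union has at least $(k-1)h+1$ elements. *)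

theory Defs
  imports Complex_Main "HOL-Library.Extended_Nat"
begin

text \<open>A hypergraph is a pair of a vertex set and a set of edges.\<close>

type_synonym 'a hypergraph = "'a set \<times> 'a set set"

definition monochromatic :: "('a \<Rightarrow> nat) \<Rightarrow> 'a set \<Rightarrow> bool" where
  "monochromatic c e \<longleftrightarrow> (\<exists>i. \<forall>x\<in>e. c x = i)"

definition proper_colouring :: "'a hypergraph \<Rightarrow> nat \<Rightarrow> ('a \<Rightarrow> nat) \<Rightarrow> bool" where
  "proper_colouring H n c \<longleftrightarrow> c ` fst H \<subseteq> {..<n} \<and> (\<forall>e\<in>snd H. \<not> monochromatic c e)"

text \<open>The infimum is \<open>\<infinity>\<close> if no finite number of colours suffices.\<close>

definition chromatic_number :: "'a hypergraph \<Rightarrow> enat" where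
  "chromatic_number H = Inf {enat n | n. \<exists>c. proper_colouring H n c}"

definition uniform_hypergraph :: "nat \<Rightarrow> 'a hypergraph \<Rightarrow> bool" where
  "uniform_hypergraph k H \<longleftrightarrow> (\<forall>e\<in>snd H. e \<subseteq> fst H \<and> finite e \<and> card e = k)"

definition girth_at_least :: "nat \<Rightarrow> 'a hypergraph \<Rightarrow> nat \<Rightarrow> bool" where
  "girth_at_least k H g \<longleftrightarrow> uniform_hypergraph k H \<and>
     (\<forall>h. 2 \<le> h \<and> h < g \<longrightarrow>
       (\<forall>F. F \<subseteq> snd H \<and> finite F \<and> card F = h \<longrightarrow> (k - 1) * h + 1 \<le> card (\<Union>F)))"

definition is_AP :: "nat \<Rightarrow> nat set \<Rightarrow> bool" where
  "is_AP k e \<longleftrightarrow> (\<exists>a d. 0 < d \<and> e = {a + i * d | i. i < k})"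

definition AP_hypergraph :: "nat \<Rightarrow> nat set \<Rightarrow> nat hypergraph" where
  "AP_hypergraph k S = (S, {e. e \<subseteq> S \<and> is_AP k e})"

text \<open>By van der Waerden's theorem, an \<open>N\<close> as below always exists when \<open>r \<ge> 1\<close>.\<close>

definition vdW :: "nat \<Rightarrow> nat \<Rightarrow> nat" where
  "vdW k r = (LEAST N. \<forall>c :: nat \<Rightarrow> nat. c ` {1..N} \<subseteq> {..<r} \<longrightarrow>
     (\<exists>e \<subseteq> {1..N}. is_AP k e \<and> monochromatic c e))"

end

theory Submission
  imports Defs "HOL-Library.FuncSet"
begin

text \<open>Let \<open>N\<close> be the bound in the statement and keep every point of \<open>{1..N}\<close> independently with
  probability \<open>p\<close>, where \<open>N * p ^ (k - 1)\<close> is a constant \<open>C\<close> depending on \<open>k\<close> and \<open>W\<close> only. The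
  expected number of short cycles is bounded by a power of \<open>C\<close>, far below \<open>p * N\<close>, so
  deleting one point from each of them yields large girth at little cost. Any two points lie in at
  most \<open>k ^ 2\<close> common progressions, so the container method applies: every progression-free set has
  a small fingerprint that determines a superset with few progressions. By
  van der Waerden's theorem, \<open>r\<close> such supersets leave a positive proportion of \<open>{1..N}\<close> uncovered,
  and a union bound over \<open>r\<close>-tuples of fingerprints shows that with high probability every
  \<open>r\<close>-colouring of the random set has a monochromatic progression, even after the deletions.\<close>

section \<open>Van der Waerden's theorem\<close>

text \<open>The deletions are the obstacle: they might restore an \<open>r\<close>-colouring, so
  non-colourability is proved against every deletion of fewer than \<open>m\<close> points, at the
  price of a factor \<open>2 ^ m\<close> in the union bound. The uncovered proportion is about
  \<open>1 / (4 * k^2 * W^3)\<close>, so a fingerprint must be shorter than \<open>p * N\<close> by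
  a power of \<open>W\<close>. Fingerprints have order \<open>k * \<tau> * N / \<beta>\<close>
  points, hence \<open>\<tau> = p / K\<close> with \<open>K\<close> as large as
  \<open>k ^ (8 * k) * W ^ 9\<close>. The container method wants \<open>\<tau> ^ (k - 1) * N\<close>
  of the order of the codegree bound \<open>k^2\<close>; this dictates
  \<open>C = k^2 * K ^ (k - 1)\<close>. Finally about \<open>(k^2 * C) ^ g\<close> cycles must be
  few against \<open>p * N\<close>, which forces \<open>N\<close> to be a power of \<open>C\<close>
  with exponent linear in \<open>g\<close>. Pairs of progressions with two common points require
  small \<open>p\<close>, and this accounts for the \<open>k\<close> in
  \<open>k + g\<close>.\<close>

definition AP :: "nat \<Rightarrow> nat \<times> nat \<Rightarrow> nat set" where
  "AP k l = (\<lambda>i. fst l + i * snd l) ` {..<k}"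

lemma is_AP_iff: "is_AP k e \<longleftrightarrow> (\<exists>a d. 0 < d \<and> e = AP k (a, d))"
proof -
  have "{a + i * d |i. i < k} = AP k (a, d)" for a d by (auto simp: AP_def)
  then show ?thesis by (simp add: is_AP_def)
qed

text \<open>The condition \<open>a + k * d < N\<close> leaves room for one more term than the \<open>k\<close> monochromatic ones:
  the focus of the colour-focusing argument.\<close>

definition vdW_prop :: "nat \<Rightarrow> bool" where
  "vdW_prop k \<longleftrightarrow> (\<forall>r. \<exists>N. \<forall>c::nat \<Rightarrow> nat. (\<forall>x. c x < r) \<longrightarrow>
     (\<exists>a d. 0 < d \<and> a + k * d < N \<and> (\<forall>i<k. c (a + i * d) = c a)))"

lemma vdW_prop_finite_colours:
  assumes "vdW_prop k" "finite Z"
  shows "\<exists>N. \<forall>c::nat \<Rightarrow> 'b. range c \<subseteq> Z \<longrightarrow>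
     (\<exists>a d. 0 < d \<and> a + k * d < N \<and> (\<forall>i<k. c (a + i * d) = c a))"
proof -
  obtain h where h: "bij_betw h Z {0..<card Z}"
    using ex_bij_betw_finite_nat[OF assms(2)] by blast
  obtain N where N: "\<And>c::nat \<Rightarrow> nat. (\<forall>x. c x < card Z) \<Longrightarrow>
     (\<exists>a d. 0 < d \<and> a + k * d < N \<and> (\<forall>i<k. c (a + i * d) = c a))"
    using assms(1) unfolding vdW_prop_def by blast
  show ?thesis
  proof (rule exI[of _ N], intro allI impI)
    fix c :: "nat \<Rightarrow> 'b" assume c: "range c \<subseteq> Z"
    have "\<forall>x. h (c x) < card Z" using h c
      by (auto simp: bij_betw_def image_subset_iff)
    from N[of "\<lambda>x. h (c x)", OF this] obtain a d where
      ad: "0 < d" "a + k * d < N" "\<forall>i<k. h (c (a + i * d)) = h (c a)" by blast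
    moreover have "\<forall>i<k. c (a + i * d) = c a"
    proof (intro allI impI)
      fix i assume "i < k"
      with ad(3) have "h (c (a + i * d)) = h (c a)" by blast
      moreover have "c (a + i * d) \<in> Z" "c a \<in> Z" using c by auto
      ultimately show "c (a + i * d) = c a" using h by (auto simp: bij_betw_def dest: inj_onD)
    qed
    ultimately show "\<exists>a d. 0 < d \<and> a + k * d < N \<and> (\<forall>i<k. c (a + i * d) = c a)" by blast
  qed
qed

section \<open>Colour focusing\<close>

definition focused :: "nat \<Rightarrow> (nat \<Rightarrow> nat) \<Rightarrow> nat \<Rightarrow> nat \<Rightarrow> (nat \<Rightarrow> nat) \<Rightarrow> (nat \<Rightarrow> nat) \<Rightarrow> bool" where
  "focused k c s f a d \<longleftrightarrow> (\<forall>j<s. 0 < d j \<and> a j + k * d j = f \<and> (\<forall>i<k. c (a j + i * d j) = c (a j)))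
     \<and> inj_on (\<lambda>j. c (a j)) {..<s}"

text \<open>Here the term with \<open>i = k\<close> has the common colour too: these are
  \<open>k + 1\<close> terms, whereas in \<open>vdW_prop k\<close> the point
  \<open>a + k * d\<close> only has to fit below \<open>N\<close>.\<close>

definition mono_AP_below :: "nat \<Rightarrow> (nat \<Rightarrow> nat) \<Rightarrow> nat \<Rightarrow> bool" where
  "mono_AP_below k c N \<longleftrightarrow> (\<exists>a d. 0 < d \<and> a + k * d < N \<and> (\<forall>i\<le>k. c (a + i * d) = c a))"

lemma mono_AP_below_shift:
  assumes "mono_AP_below k (\<lambda>x. c (b + x)) M" "b + M \<le> N"
  shows "mono_AP_below k c N"
proof -
  obtain a d where "0 < d" "a + k * d < M" "\<forall>i\<le>k. c (b + (a + i * d)) = c (b + a)"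
    using assms(1) unfolding mono_AP_below_def by blast
  then show ?thesis unfolding mono_AP_below_def
    by (intro exI[of _ "b + a"] exI[of _ d]) (use assms(2) in \<open>auto simp: add.assoc\<close>)
qed

text \<open>Blocks of length \<open>M\<close> are coloured by their patterns, and
  \<open>vdW_prop k\<close> for these finitely many patterns yields \<open>k\<close> equal blocks in
  progression. The first of them contains \<open>s\<close> focused progressions. If their focus
  \<open>f\<close> repeats one of their colours, that progression gains a term; otherwise the copies
  of \<open>f\<close> in the equal blocks form a progression in a new colour.\<close>

lemma vdW_focus:
  assumes k: "vdW_prop k" "0 < k"
  shows "\<exists>N. \<forall>c. (\<forall>x. c x < r) \<longrightarrow> mono_AP_below k c N \<or> (\<exists>f<N. \<exists>a d. focused k c s f a d)"
proof (induction s)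
  case 0
  show ?case by (rule exI[of _ 1]) (auto simp: focused_def)
next
  case (Suc s)
  then obtain M where M: "\<And>c. (\<forall>x. c x < r) \<Longrightarrow>
      mono_AP_below k c M \<or> (\<exists>f<M. \<exists>a d. focused k c s f a d)" by blast
  have "finite {xs. set xs \<subseteq> {..<r} \<and> length xs = M}" by (rule finite_lists_length_eq) simp
  from vdW_prop_finite_colours[OF k(1) this] obtain L where L: "\<And>c. range c \<subseteq> {xs. set xs \<subseteq> {..<r} \<and> length xs = M} \<Longrightarrow>
     (\<exists>a d. 0 < d \<and> a + k * d < L \<and> (\<forall>i<k. c (a + i * d) = c a))" by blast
  show ?case
  proof (rule exI[of _ "L * M"], intro allI impI)
    fix c :: "nat \<Rightarrow> nat" assume c: "\<forall>x. c x < r"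
    have "range (\<lambda>j. map (\<lambda>x. c (j * M + x)) [0..<M]) \<subseteq> {xs. set xs \<subseteq> {..<r} \<and> length xs = M}"
      using c by auto
    from L[OF this] obtain A D where AD: "0 < D" "A + k * D < L"
      and eq: "\<And>i. i < k \<Longrightarrow> map (\<lambda>x. c ((A + i * D) * M + x)) [0..<M] = map (\<lambda>x. c (A * M + x)) [0..<M]"
      by blast
    have blk: "c (A * M + x + i * (D * M)) = c (A * M + x)" if "i < k" "x < M" for i x
      using eq[OF that(1)] that(2) by (auto simp: algebra_simps)
    \<comment> \<open>The new focus lies in block \<open>A + k * D\<close>, which exists because
      \<open>vdW_prop\<close> leaves room for one more term.\<close>
    have le: "A * M + k * (D * M) + M \<le> L * M"
      using mult_le_mono1[of "Suc (A + k * D)" L M] AD(2) by (simp add: algebra_simps)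
    define c' where "c' = (\<lambda>x. c (A * M + x))"
    have "\<forall>x. c' x < r" using c by (simp add: c'_def)
    from M[OF this] show "mono_AP_below k c (L * M) \<or> (\<exists>f<L * M. \<exists>a d. focused k c (Suc s) f a d)"
    proof
      assume "mono_AP_below k c' M"
      then have "mono_AP_below k c (L * M)"
        unfolding c'_def by (rule mono_AP_below_shift) (use le in linarith)
      then show ?thesis ..
    next
      assume "\<exists>f<M. \<exists>a d. focused k c' s f a d"
      then obtain f a d where f: "f < M" and foc: "focused k c' s f a d" by blast
      have foc1: "0 < d j" "a j + k * d j = f" "\<And>i. i < k \<Longrightarrow> c' (a j + i * d j) = c' (a j)" if "j < s" for j
        using foc that unfolding focused_def by auto
      show ?thesis
      proof (cases "\<exists>j<s. c' (a j) = c' f")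
        case True
        then obtain j where j: "j < s" "c' (a j) = c' f" by blast
        have "c' (a j + i * d j) = c' (a j)" if "i \<le> k" for i
          using that foc1[OF j(1)] j(2) by (cases "i = k") auto
        then have "mono_AP_below k c' M"
          unfolding mono_AP_below_def using foc1[OF j(1)] f by blast
        then have "mono_AP_below k c (L * M)"
          unfolding c'_def by (rule mono_AP_below_shift) (use le in linarith)
        then show ?thesis ..
      next
        case False
        \<comment> \<open>The old differences grow by \<open>D * M\<close>, so that the
          \<open>i\<close>-th term moves to the \<open>i\<close>-th block; all progressions then
          meet at the copy of \<open>f\<close> in block \<open>A + k * D\<close>.\<close>
        define a' where "a' = (\<lambda>j. if j < s then A * M + a j else A * M + f)"
        define d' where "d' = (\<lambda>j. if j < s then d j + D * M else D * M)"
        have col: "c (a' j) = (if j < s then c' (a j) else c' f)" for j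
          by (simp add: a'_def c'_def)
        have M0: "0 < M" using f by simp
        have "focused k c (Suc s) (A * M + f + k * (D * M)) a' d'"
          unfolding focused_def
        proof (intro conjI allI impI)
          fix j assume "j < Suc s"
          show "0 < d' j" using M0 AD(1) by (simp add: d'_def)
          show "a' j + k * d' j = A * M + f + k * (D * M)"
            using foc1(2)[of j] by (auto simp: a'_def d'_def algebra_simps)
          fix i assume i: "i < k"
          show "c (a' j + i * d' j) = c (a' j)"
          proof (cases "j < s")
            case True
            have lt: "a j + i * d j < M"
            proof -
              have "i * d j \<le> k * d j" using i by simp
              then show ?thesis using foc1(2)[OF True] f by linarith
            qed
            have "a' j + i * d' j = A * M + (a j + i * d j) + i * (D * M)"
              using True by (simp add: a'_def d'_def algebra_simps)
            then have "c (a' j + i * d' j) = c' (a j + i * d j)"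
              using blk[OF i lt] by (simp add: c'_def)
            then show ?thesis using foc1(3)[OF True i] col True by simp
          next
            case False
            then show ?thesis using blk[OF i f] by (simp add: a'_def d'_def)
          qed
        next
          have "inj_on (\<lambda>j. c' (a j)) {..<s}" using foc by (simp add: focused_def)
          then show "inj_on (\<lambda>j. c (a' j)) {..<Suc s}"
            using False unfolding inj_on_def col by (auto simp: less_Suc_eq)
        qed
        moreover have "A * M + f + k * (D * M) < L * M" using le f by linarith
        ultimately show ?thesis by blast
      qed
    qed
  qed
qed

text \<open>Pigeonhole: \<open>r + 1\<close> focused progressions would have \<open>r + 1\<close>
  distinct colours, so the other alternative of \<open>vdW_focus\<close> holds.\<close>

lemma vdW_prop_Suc:
  assumes "vdW_prop k" "0 < k"
  shows "vdW_prop (Suc k)"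
  unfolding vdW_prop_def
proof
  fix r
  obtain N where N: "\<And>c. (\<forall>x. c x < r) \<Longrightarrow>
      mono_AP_below k c N \<or> (\<exists>f<N. \<exists>a d. focused k c (Suc r) f a d)"
    using vdW_focus[OF assms, of r "Suc r"] by blast
  show "\<exists>N. \<forall>c::nat \<Rightarrow> nat. (\<forall>x. c x < r) \<longrightarrow>
     (\<exists>a d. 0 < d \<and> a + Suc k * d < N \<and> (\<forall>i<Suc k. c (a + i * d) = c a))"
  \<comment> \<open>The room for one further term is paid for by doubling, as
    \<open>d \<le> k * d < N\<close>.\<close>
  proof (rule exI[of _ "2 * N"], intro allI impI)
    fix c :: "nat \<Rightarrow> nat" assume c: "\<forall>x. c x < r"
    have False if "focused k c (Suc r) f a d" for f a d
    proof -
      have "inj_on (\<lambda>j. c (a j)) {..<Suc r}" using that by (simp add: focused_def)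
      moreover have "(\<lambda>j. c (a j)) ` {..<Suc r} \<subseteq> {..<r}" using c by auto
      ultimately show False using card_inj_on_le[of _ "{..<Suc r}" "{..<r}"] by simp
    qed
    then have "mono_AP_below k c N" using N[OF c] by blast
    then obtain a d where ad: "0 < d" "a + k * d < N" "\<forall>i\<le>k. c (a + i * d) = c a"
      unfolding mono_AP_below_def by blast
    have "d \<le> k * d" using assms(2) by simp
    then have "a + Suc k * d < 2 * N" using ad(2) by (simp only: mult_Suc)
    then show "\<exists>a d. 0 < d \<and> a + Suc k * d < 2 * N \<and> (\<forall>i<Suc k. c (a + i * d) = c a)"
      using ad by (intro exI[of _ a] exI[of _ d]) (simp only: less_Suc_eq_le)
  qed
qed

lemma vdW_prop_all: "vdW_prop k"
proof (cases k)
  case 0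
  then show ?thesis unfolding vdW_prop_def
    by (intro allI exI[of _ "1::nat"] impI exI[of _ "0::nat"] exI[of _ "1::nat"]) simp
next
  case (Suc n)
  have "vdW_prop (Suc n)"
  proof (induction n)
    case 0
    show ?case unfolding vdW_prop_def
      by (intro allI exI[of _ "2::nat"] impI exI[of _ "0::nat"] exI[of _ "1::nat"]) simp
  next
    case (Suc n)
    then show ?case by (rule vdW_prop_Suc) simp
  qed
  with Suc show ?thesis by simp
qed

text \<open>\<open>vdW\<close> is a \<open>LEAST\<close>, so it has its defining property only once
  some \<open>N\<close> is known to have it.\<close>

theorem van_der_Waerden:
  assumes "0 < r"
  shows "\<forall>c :: nat \<Rightarrow> nat. c ` {1..vdW k r} \<subseteq> {..<r} \<longrightarrow>
     (\<exists>e \<subseteq> {1..vdW k r}. is_AP k e \<and> monochromatic c e)"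
  unfolding vdW_def
proof (rule LeastI_ex)
  obtain N where N: "\<And>c::nat \<Rightarrow> nat. (\<forall>x. c x < r) \<Longrightarrow>
     (\<exists>a d. 0 < d \<and> a + k * d < N \<and> (\<forall>i<k. c (a + i * d) = c a))"
    using vdW_prop_all[of k] unfolding vdW_prop_def by blast
  show "\<exists>N. \<forall>c :: nat \<Rightarrow> nat. c ` {1..N} \<subseteq> {..<r} \<longrightarrow>
     (\<exists>e \<subseteq> {1..N}. is_AP k e \<and> monochromatic c e)"
  proof (rule exI[of _ N], intro allI impI)
    fix c :: "nat \<Rightarrow> nat" assume c: "c ` {1..N} \<subseteq> {..<r}"
    \<comment> \<open>\<open>vdW_prop\<close> counts from 0 and wants a total colouring below
      \<open>r\<close>; hence the shift and the default colour 0.\<close>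
    define c' where "c' = (\<lambda>x. if Suc x \<in> {1..N} then c (Suc x) else 0)"
    have "\<forall>x. c' x < r" using c assms by (auto simp: c'_def image_subset_iff)
    from N[OF this] obtain a d where ad: "0 < d" "a + k * d < N" "\<forall>i<k. c' (a + i * d) = c' a" by blast
    have in_range: "Suc (a + i * d) \<in> {1..N}" if "i < k" for i
    proof -
      have "i * d \<le> k * d" using that by simp
      then have "a + i * d < N" using ad(2) by linarith
      then show ?thesis by simp
    qed
    have "c (Suc a + i * d) = c' a" if "i < k" for i
      using ad(3) in_range[OF that] that by (auto simp: c'_def)
    then have "monochromatic c (AP k (Suc a, d))" by (auto simp: monochromatic_def AP_def)
    moreover have "AP k (Suc a, d) \<subseteq> {1..N}" using in_range by (auto simp: AP_def)
    moreover have "is_AP k (AP k (Suc a, d))" using ad(1) unfolding is_AP_iff by blast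
    ultimately show "\<exists>e \<subseteq> {1..N}. is_AP k e \<and> monochromatic c e" by blast
  qed
qed

text \<open>With at least as many colours as points, an injective colouring has no monochromatic
  pair. The bound allows \<open>r\<close> to be absorbed into powers of \<open>W\<close>.\<close>

lemma colours_less_vdW:
  assumes "2 \<le> k" "0 < r"
  shows "r < vdW k r"
proof (rule ccontr)
  assume "\<not> r < vdW k r"
  then have "(\<lambda>x. x - 1) ` {1..vdW k r} \<subseteq> {..<r}" by auto
  from mp[OF spec[OF van_der_Waerden[OF assms(2), of k]] this] obtain e where
    e: "e \<subseteq> {1..vdW k r}" "is_AP k e" "monochromatic (\<lambda>x. x - 1) e" by blast
  then obtain a d where d: "0 < d" "e = AP k (a, d)" unfolding is_AP_iff by blast
  have e_mem: "a + i * d \<in> e" if "i < k" for i using that d(2) by (auto simp: AP_def)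
  have "a \<in> e" "a + d \<in> e" using e_mem[of 0] e_mem[of 1] assms(1) by simp_all
  then have "a - 1 = a + d - 1" "1 \<le> a" using e by (auto simp: monochromatic_def)
  then show False using d(1) by linarith
qed

section \<open>Query algorithms and containers\<close>

text \<open>Edges are indices \<open>e\<close> with point sets \<open>R e\<close>, because distinct
  edges can have the same link and must still be counted separately.\<close>

definition deg :: "('e \<Rightarrow> 'a set) \<Rightarrow> 'e set \<Rightarrow> 'a \<Rightarrow> nat" where
  "deg R E u = card {e \<in> E. u \<in> R e}"

lemma sum_deg:
  assumes "finite V" "finite E" "\<And>e. e \<in> E \<Longrightarrow> R e \<subseteq> V" "\<And>e. e \<in> E \<Longrightarrow> card (R e) = s"
  shows "(\<Sum>u\<in>V. deg R E u) = s * card E"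
proof -
  have "(\<Sum>u\<in>V. deg R E u) = (\<Sum>e\<in>E. card {u \<in> V. u \<in> R e})"
    unfolding deg_def using sum_multicount_gen[of V E "\<lambda>u e. u \<in> R e" "\<lambda>e. card {u \<in> V. u \<in> R e}"] assms(1,2)
    by simp
  also have "\<dots> = (\<Sum>e\<in>E. s)"
  proof (rule sum.cong)
    fix e assume e: "e \<in> E"
    then have "{u \<in> V. u \<in> R e} = R e" using assms(3) by blast
    then show "card {u \<in> V. u \<in> R e} = s" using assms(4)[OF e] by simp
  qed simp
  finally show ?thesis by (simp add: mult.commute)
qed

lemma card_covered_le:
  assumes "finite E" "finite Z" "\<And>e. e \<in> E' \<Longrightarrow> e \<in> E \<and> R e \<inter> Z \<noteq> {}"
    and "\<And>u. u \<in> Z \<Longrightarrow> real (deg R E u) \<le> M"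
  shows "real (card E') \<le> real (card Z) * M"
proof -
  have "E' \<subseteq> (\<Union>u\<in>Z. {e \<in> E. u \<in> R e})" using assms(3) by blast
  then have "card E' \<le> card (\<Union>u\<in>Z. {e \<in> E. u \<in> R e})"
    by (rule card_mono[rotated]) (use assms in auto)
  also have "\<dots> \<le> (\<Sum>u\<in>Z. deg R E u)" unfolding deg_def by (rule card_UN_le) fact
  finally have "real (card E') \<le> (\<Sum>u\<in>Z. real (deg R E u))" by (metis of_nat_le_iff of_nat_sum)
  also have "\<dots> \<le> (\<Sum>u\<in>Z. M)" by (rule sum_mono) (rule assms(4))
  finally show ?thesis by simp
qed

text \<open>A query algorithm explores an unknown set \<open>I\<close> by asking for the membership of single points; \<open>F I\<close>
  collects the points with answer yes. Running it on any \<open>J\<close> between \<open>F I\<close> and \<open>I\<close> gives the same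
  answers, so that the output \<open>G I\<close> is a function of the fingerprint \<open>F I\<close>.\<close>

definition local_query :: "('a set \<Rightarrow> 'a set) \<Rightarrow> ('a set \<Rightarrow> 'b) \<Rightarrow> bool" where
  "local_query F G \<longleftrightarrow> (\<forall>I. F I \<subseteq> I \<and> (\<forall>J. F I \<subseteq> J \<and> J \<subseteq> I \<longrightarrow> F J = F I \<and> G J = G I))"

text \<open>\<open>P\<close> specifies input, fingerprint and output. The rules below (return, query
  a point, run in sequence) assemble algorithms so that locality never has to be checked
  again.\<close>

definition queryable :: "('a set \<Rightarrow> 'a set \<Rightarrow> 'b \<Rightarrow> bool) \<Rightarrow> bool" where
  "queryable P \<longleftrightarrow> (\<exists>F G. local_query F G \<and> (\<forall>I. P I (F I) (G I)))"

lemma queryable_return: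
  assumes "\<And>I. P I {} g"
  shows "queryable P"
  unfolding queryable_def local_query_def
  by (intro exI[of _ "\<lambda>_. {}"] exI[of _ "\<lambda>_. g"]) (use assms in auto)

lemma queryable_query:
  assumes "queryable P" "queryable Q"
    and "\<And>I T g. v \<in> I \<Longrightarrow> P I T g \<Longrightarrow> T \<subseteq> I \<Longrightarrow> S I (insert v T) g"
    and "\<And>I T g. v \<notin> I \<Longrightarrow> Q I T g \<Longrightarrow> T \<subseteq> I \<Longrightarrow> S I T g"
  shows "queryable S"
proof -
  obtain F G where 1: "local_query F G" "\<And>I. P I (F I) (G I)"
    using assms(1) unfolding queryable_def by blast
  obtain F' G' where 2: "local_query F' G'" "\<And>I. Q I (F' I) (G' I)"
    using assms(2) unfolding queryable_def by blast
  have sub: "F I \<subseteq> I" "F' I \<subseteq> I" for I using 1(1) 2(1) unfolding local_query_def by blast+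
  have eq: "F I \<subseteq> J \<Longrightarrow> J \<subseteq> I \<Longrightarrow> F J = F I \<and> G J = G I" for I J
    using 1(1) unfolding local_query_def by blast
  have eq': "F' I \<subseteq> J \<Longrightarrow> J \<subseteq> I \<Longrightarrow> F' J = F' I \<and> G' J = G' I" for I J
    using 2(1) unfolding local_query_def by blast
  show ?thesis unfolding queryable_def
  proof (intro exI conjI allI)
    show "local_query (\<lambda>I. if v \<in> I then insert v (F I) else F' I) (\<lambda>I. if v \<in> I then G I else G' I)"
      unfolding local_query_def
    proof (intro allI conjI impI)
      fix I J
      assume J: "(if v \<in> I then insert v (F I) else F' I) \<subseteq> J \<and> J \<subseteq> I"
      \<comment> \<open>A yes puts \<open>v\<close> into the fingerprint and thus into
        \<open>J\<close>; a no is inherited by \<open>J \<subseteq> I\<close>. So both runs take the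
        same branch.\<close>
      then have vJ: "v \<in> J \<longleftrightarrow> v \<in> I" by (cases "v \<in> I") auto
      show "(if v \<in> J then insert v (F J) else F' J) = (if v \<in> I then insert v (F I) else F' I)"
        using J vJ eq[of I J] eq'[of I J] by (cases "v \<in> I", simp_all)
      show "(if v \<in> J then G J else G' J) = (if v \<in> I then G I else G' I)"
        using J vJ eq[of I J] eq'[of I J] by (cases "v \<in> I", simp_all)
    qed (use sub in auto)
    show "S I (if v \<in> I then insert v (F I) else F' I) (if v \<in> I then G I else G' I)" for I
      using assms(3)[OF _ 1(2) sub(1)] assms(4)[OF _ 2(2) sub(2)] by (cases "v \<in> I") simp_all
  qed
qed

text \<open>The second algorithm may depend on the output \<open>g\<close> of the first. On
  \<open>J\<close> the first stage returns the same \<open>g\<close>, so the same second stage is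
  run.\<close>

lemma queryable_bind:
  assumes "queryable P" "\<And>g. queryable (Q g)"
    and "\<And>I T g T' h. P I T g \<Longrightarrow> Q g I T' h \<Longrightarrow> T \<subseteq> I \<Longrightarrow> T' \<subseteq> I \<Longrightarrow> S I (T \<union> T') h"
  shows "queryable S"
proof -
  obtain F G where 1: "local_query F G" "\<And>I. P I (F I) (G I)"
    using assms(1) unfolding queryable_def by blast
  have "\<forall>g. \<exists>F G. local_query F G \<and> (\<forall>I. Q g I (F I) (G I))"
    using assms(2) unfolding queryable_def by blast
  then obtain F' G' where 2: "\<And>g. local_query (F' g) (G' g)" "\<And>g I. Q g I (F' g I) (G' g I)"
    by metis
  have sub: "F I \<subseteq> I" "F' g I \<subseteq> I" for g I
    using 1(1) 2(1)[of g] unfolding local_query_def by blast+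
  have eq: "F I \<subseteq> J \<Longrightarrow> J \<subseteq> I \<Longrightarrow> F J = F I \<and> G J = G I" for I J
    using 1(1) unfolding local_query_def by blast
  have eq': "F' g I \<subseteq> J \<Longrightarrow> J \<subseteq> I \<Longrightarrow> F' g J = F' g I \<and> G' g J = G' g I" for g I J
    using 2(1)[of g] unfolding local_query_def by blast
  show ?thesis unfolding queryable_def
  proof (intro exI conjI allI)
    show "local_query (\<lambda>I. F I \<union> F' (G I) I) (\<lambda>I. G' (G I) I)"
      unfolding local_query_def
    proof (intro allI conjI impI)
      fix I J
      assume J: "F I \<union> F' (G I) I \<subseteq> J \<and> J \<subseteq> I"
      then have "F J = F I" "G J = G I" using eq[of I J] by auto
      then show "F J \<union> F' (G J) J = F I \<union> F' (G I) I" "G' (G J) J = G' (G I) I"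
        using eq'[of "G I" I J] J by auto
    qed (use sub in blast)
    show "S I (F I \<union> F' (G I) I) (G' (G I) I)" for I
      by (rule assms(3)[OF 1(2) 2(2)]) (rule sub)+
  qed
qed

section \<open>One round of the container algorithm: from edges to links\<close>

locale link_step =
  fixes V :: "'a set" and E :: "'e set" and R :: "'e \<Rightarrow> 'a set" and s \<kappa> :: nat and N b D :: real
  assumes finite_V: "finite V" and finite_E: "finite E"
    and card_V: "real (card V) \<le> N" and E_nonempty: "E \<noteq> {}"
    and R_sub: "\<And>e. e \<in> E \<Longrightarrow> R e \<subseteq> V" and R_card: "\<And>e. e \<in> E \<Longrightarrow> card (R e) = s"
    and s2: "2 \<le> s"
    and codeg: "\<And>u w. u \<in> V \<Longrightarrow> w \<in> V \<Longrightarrow> u \<noteq> w \<Longrightarrow> card {e \<in> E. u \<in> R e \<and> w \<in> R e} \<le> \<kappa>"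
    and D_nonneg: "0 \<le> D"
begin

text \<open>One step of the container algorithm turns the \<open>s\<close>-uniform hypergraph \<open>(E, R)\<close> into an
  \<open>(s - 1)\<close>-uniform one, \<open>(E', R')\<close>, made of links of accepted vertices. \<open>A\<close> is the set of edges still
  available, \<open>T\<close> and \<open>X\<close> are the accepted and the rejected vertices. An edge enters \<open>E'\<close> at most once,
  which keeps codegrees bounded, and edges through vertices whose degree in \<open>(E', R')\<close> has reached
  \<open>D\<close> are discarded.\<close>

definition inv where
  "inv A E' R' T X \<longleftrightarrow> A \<subseteq> E \<and> E' \<subseteq> E \<and> A \<inter> E' = {} \<and> T \<subseteq> V \<and> X \<subseteq> V \<and>
     (\<forall>e\<in>A. R e \<inter> (T \<union> X) = {}) \<and>
     (\<forall>e\<in>E'. R' e \<subseteq> R e \<and> card (R' e) = s - 1 \<and> R e - R' e \<subseteq> T) \<and>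
     (\<forall>u\<in>V. real (deg R' E' u) \<le> D + \<kappa>) \<and>
     (\<forall>u\<in>V. D \<le> deg R' E' u \<longrightarrow> (\<forall>e\<in>A. u \<notin> R e)) \<and>
     (\<forall>e\<in>E - A. \<exists>u\<in>R e. u \<in> T \<union> X \<or> D \<le> deg R' E' u) \<and>
     real (card T) * card E \<le> N * card E' \<and> card T \<le> b + 1"

lemma inv_conjuncts:
  assumes "inv A E' R' T X"
  shows "A \<subseteq> E" "E' \<subseteq> E" "A \<inter> E' = {}" "T \<subseteq> V" "X \<subseteq> V"
    and "\<forall>e\<in>A. R e \<inter> (T \<union> X) = {}"
    and "\<forall>e\<in>E'. R' e \<subseteq> R e \<and> card (R' e) = s - 1 \<and> R e - R' e \<subseteq> T"
    and "\<forall>u\<in>V. real (deg R' E' u) \<le> D + \<kappa>"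
    and "\<forall>u\<in>V. D \<le> deg R' E' u \<longrightarrow> (\<forall>e\<in>A. u \<notin> R e)"
    and "\<forall>e\<in>E - A. \<exists>u\<in>R e. u \<in> T \<union> X \<or> D \<le> deg R' E' u"
    and "real (card T) * card E \<le> N * card E'" "card T \<le> b + 1"
  using assms unfolding inv_def
  apply -
  apply (elim conjE, assumption)+
  done

lemmas invD = inv_conjuncts[rule_format]

text \<open>Either the budget \<open>b\<close> of accepted vertices is spent, or at least half of
  the edges are no longer available; in both cases \<open>inv\<close> yields a lower bound of use in
  \<open>inv_outcome\<close>.\<close>

definition stop where "stop A T \<longleftrightarrow> b \<le> card T \<or> 2 * card A \<le> card E"

lemma N_pos: "0 < N"
proof -
  obtain e where e: "e \<in> E" using E_nonempty by blast
  then have "V \<noteq> {}" using R_card[OF e] R_sub[OF e] s2 by force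
  then have "0 < card V" using finite_V by (simp add: card_gt_0_iff)
  then show ?thesis using card_V by linarith
qed

text \<open>Averaging: since \<open>2 \<le> s\<close> and more than half of the edges remain, the
  degrees in \<open>A\<close> sum to more than \<open>card E\<close>, over at most \<open>N\<close>
  vertices.\<close>

lemma ex_high_degree:
  assumes "A \<subseteq> E" "card E < 2 * card A"
  shows "\<exists>v\<in>V. real (card E) \<le> N * deg R A v \<and> 0 < deg R A v"
proof (rule ccontr)
  assume "\<not> ?thesis"
  then have small: "N * deg R A v < card E" if "v \<in> V" for v
    using that finite_E E_nonempty by (force simp: card_gt_0_iff not_le)
  have V: "V \<noteq> {}" using card_V N_pos finite_V R_sub R_card s2 E_nonempty by force
  have "(\<Sum>u\<in>V. deg R A u) = s * card A"
    by (rule sum_deg) (use assms(1) finite_V finite_E R_sub R_card finite_subset in auto)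
  moreover have "2 * card A \<le> s * card A" using s2 by simp
  ultimately have "real (card E) < real (\<Sum>u\<in>V. deg R A u)" using assms(2) by linarith
  then have "N * card E < N * real (\<Sum>u\<in>V. deg R A u)" using N_pos by (rule mult_strict_left_mono)
  also have "\<dots> = (\<Sum>u\<in>V. N * deg R A u)" by (simp add: sum_distrib_left)
  also have "\<dots> < (\<Sum>u\<in>V. real (card E))" using V finite_V small by (intro sum_strict_mono) auto
  also have "\<dots> \<le> N * card E" using card_V by (simp add: mult_right_mono)
  finally show False by simp
qed

text \<open>An accepted vertex contributes at least \<open>card E / N\<close> new links, which
  preserves \<open>card T * card E \<le> N * card E'\<close>. The degree of \<open>u\<close> grows
  by at most \<open>\<kappa>\<close>, as the new links through \<open>u\<close> come from edges
  containing \<open>u\<close> and \<open>v\<close>; it no longer grows once it has reached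
  \<open>D\<close>, since then no available edge contains \<open>u\<close>. Hence the cap
  \<open>D + \<kappa>\<close>.\<close>

lemma inv_accept:
  fixes A E' R' T X v
  defines "L \<equiv> {e \<in> A. v \<in> R e}"
  defines "R1 \<equiv> \<lambda>e. if e \<in> L then R e - {v} else R' e"
  defines "A1 \<equiv> {e \<in> A - L. \<forall>u\<in>R e. deg R1 (E' \<union> L) u < D}"
  assumes inv: "inv A E' R' T X" and ns: "\<not> stop A T"
    and v: "v \<in> V" "real (card E) \<le> N * deg R A v" "0 < deg R A v"
  shows "inv A1 (E' \<union> L) R1 (insert v T) X" "card A1 < card A"
proof -
  note I = invD[OF inv]
  have fin: "finite A" "finite E'" "finite L" "finite T"
    using I finite_E finite_V unfolding L_def by (auto intro: finite_subset)
  have disj: "E' \<inter> L = {}" using I(3) by (auto simp: L_def)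
  have LA: "L \<subseteq> A" by (auto simp: L_def)
  have cardL: "card L = deg R A v" by (simp add: L_def deg_def)
  have Lne: "L \<noteq> {}" using cardL v(3) by auto
  have vT: "v \<notin> T" using Lne I(6) by (auto simp: L_def)
  have deg1: "deg R1 (E' \<union> L) u = deg R' E' u + card {e \<in> L. u \<in> R e \<and> u \<noteq> v}" for u
  proof -
    have "{e \<in> E' \<union> L. u \<in> R1 e} = {e \<in> E'. u \<in> R' e} \<union> {e \<in> L. u \<in> R e \<and> u \<noteq> v}"
      using disj by (auto simp: R1_def)
    moreover have "card \<dots> = card {e \<in> E'. u \<in> R' e} + card {e \<in> L. u \<in> R e \<and> u \<noteq> v}"
      by (rule card_Un_disjoint) (use fin disj in auto)
    ultimately show ?thesis by (simp add: deg_def)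
  qed
  have add_le: "card {e \<in> L. u \<in> R e \<and> u \<noteq> v} \<le> \<kappa>" if "u \<in> V" for u
  proof (cases "u = v")
    case False
    have "card {e \<in> L. u \<in> R e \<and> u \<noteq> v} \<le> card {e \<in> E. v \<in> R e \<and> u \<in> R e}"
      using I(1) finite_E by (intro card_mono) (auto simp: L_def)
    then show ?thesis using codeg[OF v(1) that] False by simp
  qed simp
  have d1: "real (deg R1 (E' \<union> L) u) \<le> D + \<kappa>" if "u \<in> V" for u
  proof (cases "D \<le> deg R' E' u")
    case True
    then have "{e \<in> L. u \<in> R e \<and> u \<noteq> v} = {}" using I(9)[OF that True] LA by blast
    then have "card {e \<in> L. u \<in> R e \<and> u \<noteq> v} = 0" by (simp only: card.empty)
    then show ?thesis using I(8)[OF that] by (simp add: deg1)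
  next
    case False
    then show ?thesis using add_le[OF that] by (simp add: deg1)
  qed
  have d1_ge: "deg R' E' u \<le> deg R1 (E' \<union> L) u" for u by (simp add: deg1)
  show "inv A1 (E' \<union> L) R1 (insert v T) X"
    unfolding inv_def
  proof (intro conjI ballI impI)
    show "A1 \<subseteq> E" "E' \<union> L \<subseteq> E" "A1 \<inter> (E' \<union> L) = {}" using I(1,2,3) LA by (auto simp: A1_def)
    show "insert v T \<subseteq> V" "X \<subseteq> V" using I(4,5) v(1) by auto
    show "R e \<inter> (insert v T \<union> X) = {}" if "e \<in> A1" for e
      using that I(6)[of e] by (auto simp: A1_def L_def)
    show "real (deg R1 (E' \<union> L) u) \<le> D + \<kappa>" if "u \<in> V" for u by (rule d1[OF that])
    show "u \<notin> R e" if "u \<in> V" "D \<le> deg R1 (E' \<union> L) u" "e \<in> A1" for u e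
      using that by (auto simp: A1_def)
    show "\<exists>u\<in>R e. u \<in> insert v T \<union> X \<or> D \<le> deg R1 (E' \<union> L) u" if "e \<in> E - A1" for e
    proof (cases "e \<in> A")
      case True
      then show ?thesis using that by (auto simp: A1_def L_def not_less)
    next
      case False
      then obtain u where "u \<in> R e" "u \<in> T \<union> X \<or> D \<le> deg R' E' u" using \<open>e \<in> E - A1\<close> I(10)[of e] by blast
      then show ?thesis using d1_ge[of u] by (intro bexI[of _ u]) auto
    qed
    have "real (card (insert v T)) * card E = real (card T) * card E + card E"
      using vT fin by (simp add: algebra_simps)
    also have "\<dots> \<le> N * card E' + N * card L" using I(11) v(2) cardL by simp
    also have "\<dots> = N * card (E' \<union> L)" using fin disj by (simp add: card_Un_disjoint algebra_simps)
    finally show "real (card (insert v T)) * card E \<le> N * card (E' \<union> L)" .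
    show "card (insert v T) \<le> b + 1" using ns vT fin by (simp add: stop_def)
    fix e assume e: "e \<in> E' \<union> L"
    show "R1 e \<subseteq> R e" using e I(7)[of e] by (auto simp: R1_def)
    show "R e - R1 e \<subseteq> insert v T" using e I(7)[of e] by (auto simp: R1_def)
    show "card (R1 e) = s - 1"
    proof (cases "e \<in> L")
      case True
      then have "e \<in> E" "v \<in> R e" using I(1) by (auto simp: L_def)
      then show ?thesis using True R_card by (simp add: R1_def)
    next
      case False
      then show ?thesis using e I(7) by (simp add: R1_def)
    qed
  qed
  have "A1 \<subset> A" using Lne LA by (auto simp: A1_def)
  then show "card A1 < card A" using fin by (simp add: psubset_card_mono)
qed

lemma inv_reject:
  fixes A v
  defines "A1 \<equiv> {e \<in> A. v \<notin> R e}"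
  assumes inv: "inv A E' R' T X" and v: "v \<in> V" "0 < deg R A v"
  shows "inv A1 E' R' T (insert v X)" "card A1 < card A"
proof -
  show "inv A1 E' R' T (insert v X)"
    unfolding inv_def
  proof (intro conjI)
    show "A1 \<subseteq> E" "A1 \<inter> E' = {}" "insert v X \<subseteq> V"
      using invD(1,3,5)[OF inv] v(1) by (auto simp: A1_def)
    show "\<forall>e\<in>A1. R e \<inter> (T \<union> insert v X) = {}" using invD(6)[OF inv] by (auto simp: A1_def)
    show "\<forall>u\<in>V. D \<le> deg R' E' u \<longrightarrow> (\<forall>e\<in>A1. u \<notin> R e)"
      using invD(9)[OF inv] by (auto simp: A1_def)
    show "\<forall>e\<in>E - A1. \<exists>u\<in>R e. u \<in> T \<union> insert v X \<or> D \<le> deg R' E' u"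
    proof
      fix e assume "e \<in> E - A1"
      then have "e \<in> E - A \<or> v \<in> R e" by (auto simp: A1_def)
      then show "\<exists>u\<in>R e. u \<in> T \<union> insert v X \<or> D \<le> deg R' E' u"
      proof
        assume "e \<in> E - A"
        then show ?thesis using invD(10)[OF inv] by blast
      qed auto
    qed
  qed (use inv_conjuncts[OF inv] in blast)+
  have "finite A" using inv finite_E unfolding inv_def by (auto intro: finite_subset)
  moreover have "A1 \<subset> A" using v(2) by (auto simp: A1_def deg_def card_gt_0_iff)
  ultimately show "card A1 < card A" by (simp add: psubset_card_mono)
qed

text \<open>The next query depends on the state and not on \<open>I\<close>, and either answer
  shrinks \<open>A\<close>. The premise on \<open>T\<close> and \<open>X\<close> says that the
  earlier answers were those for \<open>I\<close>; it lets the specification speak of every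
  \<open>I\<close>, even one that never leads to this state.\<close>

lemma queryable_inv:
  "inv A E' R' T X \<Longrightarrow> queryable (\<lambda>I T' (X', E'', R''). T \<subseteq> I \<and> X \<inter> I = {} \<longrightarrow>
     X' \<inter> I = {} \<and> (\<exists>A'. inv A' E'' R'' (T \<union> T') X' \<and> stop A' (T \<union> T')))"
proof (induction "card A" arbitrary: A E' R' T X rule: less_induct)
  case less
  show ?case
  proof (cases "stop A T")
    case True
    then show ?thesis using less.prems by (intro queryable_return[of _ "(X, E', R')"]) auto
  next
    case False
    have "A \<subseteq> E" by (rule invD(1)[OF less.prems])
    with False obtain v where v: "v \<in> V" "real (card E) \<le> N * deg R A v" "0 < deg R A v"
      using ex_high_degree[of A] unfolding stop_def by auto
    show ?thesis
      by (rule queryable_query[where v = v,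
            OF less.hyps[OF inv_accept(2,1)[OF less.prems False v]]
               less.hyps[OF inv_reject(2,1)[OF less.prems v(1,3)]]])
        auto
  qed
qed

text \<open>If \<open>b\<close> vertices were accepted,
  \<open>card T * card E \<le> N * card E'\<close> alone gives enough links. Otherwise half of the
  edges meet \<open>T\<close>, \<open>X\<close> or the set \<open>Y\<close> of saturated vertices,
  which therefore have at least \<open>\<alpha> * N / 2\<close> points together. \<open>T\<close> is
  small; if \<open>X\<close> is small too, \<open>Y\<close> has at least
  \<open>\<alpha> * N / 4\<close> points of degree at least \<open>D\<close>, and the degree sum of
  the links bounds \<open>card E'\<close> from below.\<close>

lemma inv_outcome:
  fixes k :: nat
  assumes "inv A E' R' T X" "stop A T"
    and M: "\<And>u. u \<in> V \<Longrightarrow> real (deg R E u) \<le> M" "0 < M"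
    and E: "\<alpha> * N * M \<le> card E" "0 \<le> \<alpha>"
    and par: "b = \<tau> * N" "D = \<tau> * M" "\<tau> \<le> \<alpha> / 8" "0 \<le> \<tau>" "s \<le> k"
  shows "\<alpha> * N / 8 \<le> card X \<or> \<alpha> / (8 * k) * N * (2 * \<tau> * M) \<le> card E'"
proof -
  note I = invD(1,2,4,5,7,10,11)[OF assms(1)]
  have k2: "2 \<le> real k" using s2 par(5) by simp
  show ?thesis
  proof (cases "b \<le> card T")
    case True
    have "N * (\<alpha> * N * M * \<tau>) = b * (\<alpha> * N * M)" by (simp add: par(1))
    also have "\<dots> \<le> real (card T) * real (card E)"
      using True E M(2) N_pos par by (intro mult_mono) auto
    also have "\<dots> \<le> N * card E'" by (rule I(7))
    finally have "\<alpha> * N * M * \<tau> \<le> card E'" using N_pos by simp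
    moreover have "\<alpha> / (8 * k) * N * (2 * \<tau> * M) = (\<alpha> * N * M * \<tau>) * (1 / (4 * k))" by simp
    moreover have "(\<alpha> * N * M * \<tau>) * (1 / (4 * k)) \<le> (\<alpha> * N * M * \<tau>) * 1"
      using k2 E(2) N_pos M(2) par(4) by (intro mult_left_mono) auto
    ultimately show ?thesis by linarith
  next
    case False
    define Y where "Y = {u \<in> V. D \<le> deg R' E' u}"
    have fin: "finite T" "finite X" "finite Y" "finite E'" "finite A"
      using I finite_V finite_E by (auto simp: Y_def intro: finite_subset)
    have half: "2 * card A \<le> card E" using False assms(2) by (simp add: stop_def)
    have "real (card (E - A)) \<le> real (card (T \<union> X \<union> Y)) * M"
    proof (rule card_covered_le[of E _ _ R])
      fix e assume e: "e \<in> E - A"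
      then show "e \<in> E \<and> R e \<inter> (T \<union> X \<union> Y) \<noteq> {}"
        using I(6)[OF e] R_sub[of e] by (auto simp: Y_def)
    qed (use fin finite_E M I in \<open>auto simp: Y_def\<close>)
    moreover have "card (E - A) = card E - card A" using fin I by (simp add: card_Diff_subset)
    ultimately have "real (card E) / 2 \<le> real (card (T \<union> X \<union> Y)) * M" using half by simp
    moreover have "card (T \<union> X \<union> Y) \<le> card T + card X + card Y"
      using card_Un_le[of "T \<union> X" Y] card_Un_le[of T X] by linarith
    then have "real (card (T \<union> X \<union> Y)) * M \<le> (real (card T) + card X + card Y) * M"
      using M(2) by (intro mult_right_mono) auto
    ultimately have "(\<alpha> * N / 2) * M \<le> (real (card T) + card X + card Y) * M" using E(1) by simp
    then have *: "\<alpha> * N / 2 \<le> real (card T) + card X + card Y" using M(2) by simp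
    have "b \<le> \<alpha> / 8 * N" unfolding par(1) using par(3) N_pos by (intro mult_right_mono) auto
    then have T: "card T \<le> \<alpha> * N / 8" using False by simp
    show ?thesis
    proof (cases "\<alpha> * N / 8 \<le> card X")
      case False
      then have "\<alpha> * N / 4 \<le> card Y" using * T by simp
      then have "\<alpha> * N / 4 * D \<le> card Y * D" using D_nonneg by (rule mult_right_mono)
      also have "card Y * D = (\<Sum>u\<in>Y. D)" by simp
      also have "\<dots> \<le> (\<Sum>u\<in>Y. real (deg R' E' u))" by (rule sum_mono) (simp add: Y_def)
      also have "\<dots> \<le> (\<Sum>u\<in>V. real (deg R' E' u))" using finite_V by (intro sum_mono2) (auto simp: Y_def)
      also have "\<dots> = real (\<Sum>u\<in>V. deg R' E' u)" by simp
      also have "(\<Sum>u\<in>V. deg R' E' u) = (s - 1) * card E'"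
        using I(2,5) R_sub fin finite_V by (intro sum_deg) blast+
      also have "real ((s - 1) * card E') \<le> real (k * card E')"
        using par(5) by (simp only: of_nat_le_iff, intro mult_right_mono) auto
      finally have "\<alpha> * N / 4 * (\<tau> * M) \<le> k * card E'" by (simp add: par(2))
      then show ?thesis using k2 by (simp add: field_simps)
    qed simp
  qed
qed

end

text \<open>Each round either rejects enough vertices or passes to links: the uniformity drops by
  one, \<open>\<alpha>\<close> by a factor \<open>8 * k\<close>, and \<open>M\<close> becomes
  \<open>2 * \<tau> * M\<close>. At uniformity one the edges are points that cannot lie in
  \<open>I\<close>. The hypothesis on \<open>2 * \<kappa>\<close> ensures
  \<open>\<kappa> \<le> \<tau> * M\<close> in every round, so that the cap
  \<open>D + \<kappa>\<close> is within the next degree bound.\<close>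

lemma queryable_link_chain:
  fixes R :: "'e \<Rightarrow> 'a set" and k s \<kappa> :: nat and N M \<alpha> \<tau> :: real
  assumes V: "finite V" "real (card V) \<le> N" "0 < N" and \<tau>: "0 < \<tau>" "2 * \<tau> \<le> 1"
    and s: "1 \<le> s" "s \<le> k"
    and E: "finite E" "\<And>e. e \<in> E \<Longrightarrow> R e \<subseteq> V" "\<And>e. e \<in> E \<Longrightarrow> card (R e) = s"
    and codeg: "\<And>u w. u \<in> V \<Longrightarrow> w \<in> V \<Longrightarrow> u \<noteq> w \<Longrightarrow> card {e \<in> E. u \<in> R e \<and> w \<in> R e} \<le> \<kappa>"
    and M: "0 < M" "\<And>u. u \<in> V \<Longrightarrow> real (deg R E u) \<le> M"
    and \<alpha>: "0 < \<alpha>" "\<alpha> * N * M \<le> card E"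
    and \<beta>: "\<beta> = \<alpha> / (8 * k) ^ (s - 1)" "\<tau> \<le> \<beta> / 8" "2 * \<kappa> \<le> (2 * \<tau>) ^ (s - 1) * M"
  shows "queryable (\<lambda>I T X. (\<forall>e\<in>E. \<not> R e \<subseteq> I) \<longrightarrow>
    X \<inter> I = {} \<and> X \<subseteq> V \<and> \<beta> * N \<le> card X \<and> card T \<le> (s - 1) * (\<tau> * N + 1))"
  using s E codeg M \<alpha> \<beta>
proof (induction s arbitrary: E R M \<alpha> rule: nat_induct_at_least)
  case base
  define X where "X = (\<Union>e\<in>E. R e)"
  have X: "X \<subseteq> V" using base.prems(3) by (auto simp: X_def)
  have "real (card E) \<le> real (card X) * M"
  proof (rule card_covered_le[of E _ _ R])
    fix e assume e: "e \<in> E"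
    then have "R e \<noteq> {}" using base.prems(4)[OF e] by force
    then show "e \<in> E \<and> R e \<inter> X \<noteq> {}" using e by (auto simp: X_def)
  qed (use base.prems X V in \<open>auto intro: finite_subset\<close>)
  then have "\<alpha> * N * M \<le> card X * M" using base.prems by linarith
  then have big: "\<beta> * N \<le> card X" using base.prems by simp
  have "X \<inter> I = {}" if "\<forall>e\<in>E. \<not> R e \<subseteq> I" for I
  proof -
    have "u \<notin> I" if "e \<in> E" "u \<in> R e" for e u
      using that base.prems(4)[OF that(1)] \<open>\<forall>e\<in>E. \<not> R e \<subseteq> I\<close> by (fastforce simp: card_1_singleton_iff)
    then show ?thesis by (auto simp: X_def)
  qed
  then show ?case using X big by (intro queryable_return[of _ X]) auto
next
  case (Suc s)
  note sk = \<open>Suc s \<le> k\<close>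
  have E: "finite E" "\<And>e. e \<in> E \<Longrightarrow> R e \<subseteq> V" "\<And>e. e \<in> E \<Longrightarrow> card (R e) = Suc s"
    and codeg: "\<And>u w. u \<in> V \<Longrightarrow> w \<in> V \<Longrightarrow> u \<noteq> w \<Longrightarrow> card {e \<in> E. u \<in> R e \<and> w \<in> R e} \<le> \<kappa>"
    and M: "0 < M" "\<And>u. u \<in> V \<Longrightarrow> real (deg R E u) \<le> M"
    and \<alpha>: "0 < \<alpha>" "\<alpha> * N * M \<le> card E"
    and \<beta>: "\<beta> = \<alpha> / (8 * k) ^ s" "\<tau> \<le> \<beta> / 8" "2 * \<kappa> \<le> (2 * \<tau>) ^ s * M"
    using Suc.prems by auto
  have "0 < \<alpha> * N * M" using \<alpha> V M by simp
  then have Ene: "E \<noteq> {}" using \<alpha>(2) by auto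
  have k8: "1 \<le> real (8 * k)" using sk by simp
  have pow8: "8 \<le> real (8 * k) ^ s"
  proof -
    have "8 \<le> real (8 * k) ^ 1" using sk by simp
    also have "\<dots> \<le> real (8 * k) ^ s" by (rule power_increasing) (use k8 Suc.hyps in auto)
    finally show ?thesis .
  qed
  have \<beta>\<alpha>: "\<beta> \<le> \<alpha> / 8" unfolding \<beta>(1) using pow8 \<alpha>(1) by (intro divide_left_mono) auto
  have \<beta>0: "0 < \<beta>" using \<tau> \<beta>(2) by linarith
  have \<kappa>: "\<kappa> \<le> \<tau> * M"
  proof -
    have "(2 * \<tau>) ^ s \<le> (2 * \<tau>) ^ 1" using \<tau> Suc.hyps by (intro power_decreasing) auto
    then have "(2 * \<tau>) ^ s * M \<le> 2 * \<tau> * M" using M(1) by (intro mult_right_mono) auto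
    then show ?thesis using \<beta>(3) by simp
  qed
  interpret link_step V E R "Suc s" \<kappa> N "\<tau> * N" "\<tau> * M"
    using V E Ene codeg M(1) \<tau>(1) Suc.hyps by unfold_locales auto
  have inv0: "inv E {} R {} {}"
    unfolding inv_def deg_def using mult_pos_pos[OF \<tau>(1) M(1)] \<tau>(1) V(3) by simp
  let ?\<alpha>' = "\<alpha> / (8 * k)" and ?M' = "2 * \<tau> * M"
  define big :: "'a set \<Rightarrow> bool" where "big X \<longleftrightarrow> \<alpha> * N / 8 \<le> card X" for X
  define good :: "'e set \<Rightarrow> ('e \<Rightarrow> 'a set) \<Rightarrow> bool" where
    "good E' R' \<longleftrightarrow> E' \<subseteq> E \<and> (\<forall>e\<in>E'. R' e \<subseteq> R e \<and> card (R' e) = s) \<and>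
       (\<forall>u\<in>V. deg R' E' u \<le> ?M') \<and> ?\<alpha>' * N * ?M' \<le> card E'" for E' R'
  \<comment> \<open>The second stage must be specified for every conceivable output of the first;
    the premise \<open>good E' R'\<close> makes it vacuous for those that do not arise.\<close>
  let ?Q = "\<lambda>(X', E', R') I T X. if big X' then T = {} \<and> X = X' else
      good E' R' \<longrightarrow> (\<forall>e\<in>E'. \<not> R' e \<subseteq> I) \<longrightarrow>
        X \<inter> I = {} \<and> X \<subseteq> V \<and> \<beta> * N \<le> card X \<and> card T \<le> (s - 1) * (\<tau> * N + 1)"
  have Q: "queryable (?Q g)" for g :: "'a set \<times> 'e set \<times> ('e \<Rightarrow> 'a set)"
  proof -
    obtain X' E' R' where g: "g = (X', E', R')" by (cases g)
    show ?thesis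
    proof (cases "\<not> big X' \<and> good E' R'")
      case False
      then show ?thesis by (intro queryable_return[of _ X']) (auto simp: g)
    next
      case True
      then have good: "E' \<subseteq> E" "\<And>e. e \<in> E' \<Longrightarrow> R' e \<subseteq> R e" "\<And>e. e \<in> E' \<Longrightarrow> card (R' e) = s"
        "\<And>u. u \<in> V \<Longrightarrow> deg R' E' u \<le> ?M'" "?\<alpha>' * N * ?M' \<le> card E'" by (auto simp: good_def)
      have "queryable (\<lambda>I T X. (\<forall>e\<in>E'. \<not> R' e \<subseteq> I) \<longrightarrow>
        X \<inter> I = {} \<and> X \<subseteq> V \<and> \<beta> * N \<le> card X \<and> card T \<le> (s - 1) * (\<tau> * N + 1))"
      proof (rule Suc.IH[of E' R' ?M' ?\<alpha>'])
        show "s \<le> k" using sk by simp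
        show "finite E'" using good(1) E(1) by (rule finite_subset)
        show "R' e \<subseteq> V" if "e \<in> E'" for e using good(1,2) E(2) that by blast
        show "card {e \<in> E'. u \<in> R' e \<and> w \<in> R' e} \<le> \<kappa>" if "u \<in> V" "w \<in> V" "u \<noteq> w" for u w
        proof -
          have "card {e \<in> E'. u \<in> R' e \<and> w \<in> R' e} \<le> card {e \<in> E. u \<in> R e \<and> w \<in> R e}"
            using good(1,2) E(1) by (intro card_mono) auto
          then show ?thesis using codeg[OF that] by simp
        qed
        show "0 < ?M'" using \<tau>(1) M(1) by simp
        show "0 < ?\<alpha>'" using \<alpha>(1) k8 by simp
        have "s = Suc (s - 1)" using Suc.hyps by simp
        then have pow: "x ^ s = x * x ^ (s - 1)" for x :: real by (metis power_Suc)
        show "\<beta> = ?\<alpha>' / (8 * k) ^ (s - 1)" unfolding \<beta>(1) using pow by simp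
        show "real (2 * \<kappa>) \<le> (2 * \<tau>) ^ (s - 1) * ?M'"
          using \<beta>(3) pow[of "2 * \<tau>"] by (simp add: mult_ac)
      qed (use good \<beta> in auto)
      then show ?thesis using True by (simp add: g)
    qed
  qed
  show ?case
  proof (rule queryable_bind[OF queryable_inv[OF inv0] Q], intro impI)
    fix I T T' X and g :: "'a set \<times> 'e set \<times> ('e \<Rightarrow> 'a set)"
    obtain X' E' R' where g: "g = (X', E', R')" by (cases g)
    assume P: "case g of (X', E'', R'') \<Rightarrow> {} \<subseteq> I \<and> {} \<inter> I = {} \<longrightarrow>
         X' \<inter> I = {} \<and> (\<exists>A'. inv A' E'' R'' ({} \<union> T) X' \<and> stop A' ({} \<union> T))"
      and q: "?Q g I T' X" and TI: "T \<subseteq> I" "T' \<subseteq> I" and indep: "\<forall>e\<in>E. \<not> R e \<subseteq> I"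
    obtain A' where A': "inv A' E' R' T X'" "stop A' T" and X'I: "X' \<inter> I = {}"
      using P by (auto simp: g)
    note J = invD[OF A'(1)]
    have cardT: "card T \<le> \<tau> * N + 1" by (rule J(12))
    have cardTT: "real (card (T \<union> T')) \<le> card T + card T'"
      using card_Un_le[of T T'] by (metis of_nat_add of_nat_le_iff)
    have "X \<inter> I = {} \<and> X \<subseteq> V \<and> \<beta> * N \<le> card X \<and> card T' \<le> (s - 1) * (\<tau> * N + 1)"
    proof (cases "big X'")
      case True
      then have "T' = {}" "X = X'" using q by (auto simp: g)
      moreover have "\<beta> * N \<le> card X'"
      proof -
        have "\<beta> * N \<le> \<alpha> / 8 * N" using \<beta>\<alpha> V(3) by (intro mult_right_mono) auto
        then show ?thesis using True by (simp add: big_def)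
      qed
      ultimately show ?thesis using X'I J(5) \<tau>(1) V(3) by simp
    next
      case False
      have "\<alpha> * N / 8 \<le> card X' \<or> \<alpha> / (8 * k) * N * (2 * \<tau> * M) \<le> card E'"
      proof (rule inv_outcome[OF A' M(2,1) \<alpha>(2) _ refl refl _ _ sk])
        show "\<tau> \<le> \<alpha> / 8" using \<beta>\<alpha> \<beta>(2) \<beta>0 by linarith
      qed (use \<alpha>(1) \<tau>(1) in auto)
      then have "?\<alpha>' * N * ?M' \<le> card E'" using False by (simp add: big_def)
      moreover have "deg R' E' u \<le> ?M'" if "u \<in> V" for u using J(8)[OF that] \<kappa> by simp
      ultimately have "good E' R'" using J(2,7) by (auto simp: good_def)
      \<comment> \<open>The edge is its link plus accepted vertices, all in \<open>I\<close>; a link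
        inside \<open>I\<close> would put the whole edge inside \<open>I\<close>.\<close>
      moreover have "\<not> R' e \<subseteq> I" if "e \<in> E'" for e
        using J(2) J(7)[OF that] TI(1) indep that by blast
      ultimately show ?thesis using q False by (simp add: g)
    qed
    moreover have "real (Suc s - 1) * (\<tau> * N + 1) = (\<tau> * N + 1) + real (s - 1) * (\<tau> * N + 1)"
      using Suc.hyps by (simp add: of_nat_diff algebra_simps)
    ultimately show "X \<inter> I = {} \<and> X \<subseteq> V \<and> \<beta> * N \<le> card X \<and> card (T \<union> T') \<le> (Suc s - 1) * (\<tau> * N + 1)"
      using cardT cardTT by linarith
  qed
qed

text \<open>While the container \<open>C\<close> spans at least \<open>\<alpha> * N * M\<close>
  edges, a chain of links finds \<open>\<beta> * N\<close> points of \<open>C\<close> outside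
  \<open>I\<close>, which are removed. One chain costs at most \<open>t\<close> fingerprint points;
  charging \<open>t / (\<beta> * N)\<close> to each removed point bounds the total cost by
  \<open>t / \<beta>\<close>.\<close>

theorem containers:
  fixes R :: "'e \<Rightarrow> 'a set" and k \<kappa> :: nat and N M \<alpha> \<beta> \<tau> :: real
  assumes V: "finite V" "real (card V) \<le> N" "0 < N" and \<tau>: "0 < \<tau>" "2 * \<tau> \<le> 1"
    and k: "1 \<le> k"
    and H: "finite H" "\<And>e. e \<in> H \<Longrightarrow> R e \<subseteq> V" "\<And>e. e \<in> H \<Longrightarrow> card (R e) = k"
    and codeg: "\<And>u w. u \<in> V \<Longrightarrow> w \<in> V \<Longrightarrow> u \<noteq> w \<Longrightarrow> card {e \<in> H. u \<in> R e \<and> w \<in> R e} \<le> \<kappa>"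
    and M: "0 < M" "\<And>u. u \<in> V \<Longrightarrow> real (deg R H u) \<le> M"
    and \<alpha>: "0 < \<alpha>"
    and \<beta>: "\<beta> = \<alpha> / (8 * k) ^ (k - 1)" "\<tau> \<le> \<beta> / 8" "2 * \<kappa> \<le> (2 * \<tau>) ^ (k - 1) * M"
  shows "\<exists>f. \<forall>I. I \<subseteq> V \<and> (\<forall>e\<in>H. \<not> R e \<subseteq> I) \<longrightarrow>
    (\<exists>T\<subseteq>I. card T * \<beta> \<le> (k - 1) * (\<tau> * N + 1) \<and> I \<subseteq> f T \<and> f T \<subseteq> V \<and>
       card {e \<in> H. R e \<subseteq> f T} < \<alpha> * N * M)"
proof -
  define t where "t = (k - 1) * (\<tau> * N + 1)"
  have t0: "0 \<le> t" using \<tau>(1) V(3) by (simp add: t_def)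
  have \<beta>0: "0 < \<beta>" using \<tau> \<beta>(2) by linarith
  have step: "queryable (\<lambda>I T C'. I \<subseteq> C \<and> (\<forall>e\<in>H. \<not> R e \<subseteq> I) \<longrightarrow>
      card T * (\<beta> * N) \<le> t * card C \<and> I \<subseteq> C' \<and> C' \<subseteq> V \<and> card {e \<in> H. R e \<subseteq> C'} < \<alpha> * N * M)"
    if "C \<subseteq> V" for C
    using that
  proof (induction "card C" arbitrary: C rule: less_induct)
    case less
    let ?E = "{e \<in> H. R e \<subseteq> C}"
    have finC: "finite C" using less.prems V(1) by (rule finite_subset)
    show ?case
    proof (cases "card ?E < \<alpha> * N * M")
      case True
      then show ?thesis using less.prems t0 by (intro queryable_return[of _ C]) auto
    next
      case False
      have chain: "queryable (\<lambda>I T X. (\<forall>e\<in>?E. \<not> R e \<subseteq> I) \<longrightarrow>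
        X \<inter> I = {} \<and> X \<subseteq> C \<and> \<beta> * N \<le> card X \<and> card T \<le> (k - 1) * (\<tau> * N + 1))"
      proof (rule queryable_link_chain[OF finC _ V(3) \<tau> k order_refl])
        \<comment> \<open>\<open>N\<close> keeps referring to the original ground set while
          \<open>C\<close> shrinks, so all runs have the same thresholds.\<close>
        show "real (card C) \<le> N" using card_mono[OF V(1) less.prems] V(2) by linarith
        show "finite ?E" using H(1) by simp
        show "card {e \<in> ?E. u \<in> R e \<and> w \<in> R e} \<le> \<kappa>" if "u \<in> C" "w \<in> C" "u \<noteq> w" for u w
        proof -
          have "card {e \<in> ?E. u \<in> R e \<and> w \<in> R e} \<le> card {e \<in> H. u \<in> R e \<and> w \<in> R e}"
            using H(1) by (intro card_mono) auto
          also have "\<dots> \<le> \<kappa>" using that less.prems by (intro codeg) auto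
          finally show ?thesis .
        qed
        show "real (deg R ?E u) \<le> M" if "u \<in> C" for u
        proof -
          have "deg R ?E u \<le> deg R H u" unfolding deg_def using H(1) by (intro card_mono) auto
          then show ?thesis using M(2)[of u] that less.prems by auto
        qed
        show "0 < M" "0 < \<alpha>" "\<beta> = \<alpha> / (8 * k) ^ (k - 1)" "\<tau> \<le> \<beta> / 8"
          "2 * \<kappa> \<le> (2 * \<tau>) ^ (k - 1) * M" by fact+
        show "\<alpha> * N * M \<le> card ?E" using False by simp
      qed (use H in auto)
      define bad where "bad X \<longleftrightarrow> \<not> (X \<subseteq> C \<and> \<beta> * N \<le> card X)" for X
      have rest: "queryable (\<lambda>I T C'. bad X \<or> (I \<subseteq> C - X \<and> (\<forall>e\<in>H. \<not> R e \<subseteq> I) \<longrightarrow>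
        card T * (\<beta> * N) \<le> t * card (C - X) \<and> I \<subseteq> C' \<and> C' \<subseteq> V \<and>
        card {e \<in> H. R e \<subseteq> C'} < \<alpha> * N * M))" for X
      proof (cases "bad X")
        case True
        then show ?thesis by (intro queryable_return) auto
      next
        case False
        have "0 < \<beta> * N" using \<beta>0 V(3) by simp
        with False have "0 < real (card X)" unfolding bad_def by linarith
        then have "X \<noteq> {}" by auto
        then have "C - X \<subset> C" using False by (auto simp: bad_def)
        then have "card (C - X) < card C" using finC by (rule psubset_card_mono[rotated])
        then show ?thesis using less.hyps[of "C - X"] less.prems False by auto
      qed
      show ?thesis
      proof (rule queryable_bind[OF chain rest], intro impI)
        fix I T T' C' :: "'a set" and X
        assume P: "(\<forall>e\<in>?E. \<not> R e \<subseteq> I) \<longrightarrow> X \<inter> I = {} \<and> X \<subseteq> C \<and> \<beta> * N \<le> card X \<and> card T \<le> (k - 1) * (\<tau> * N + 1)"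
          and Q: "bad X \<or> (I \<subseteq> C - X \<and> (\<forall>e\<in>H. \<not> R e \<subseteq> I) \<longrightarrow>
            card T' * (\<beta> * N) \<le> t * card (C - X) \<and> I \<subseteq> C' \<and> C' \<subseteq> V \<and> card {e \<in> H. R e \<subseteq> C'} < \<alpha> * N * M)"
          and I: "I \<subseteq> C \<and> (\<forall>e\<in>H. \<not> R e \<subseteq> I)"
        have X: "X \<inter> I = {}" "X \<subseteq> C" "\<beta> * N \<le> card X" "card T \<le> t" using P I by (auto simp: t_def)
        then have Q': "card T' * (\<beta> * N) \<le> t * card (C - X)" "I \<subseteq> C'" "C' \<subseteq> V" "card {e \<in> H. R e \<subseteq> C'} < \<alpha> * N * M"
          using Q I by (auto simp: bad_def)
        have "card (T \<union> T') * (\<beta> * N) \<le> (real (card T) + card T') * (\<beta> * N)"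
          using card_Un_le[of T T'] \<beta>0 V(3)
          by (intro mult_right_mono) (simp_all flip: of_nat_add add: of_nat_le_iff)
        also have "\<dots> = card T * (\<beta> * N) + card T' * (\<beta> * N)" by (simp add: distrib_right)
        also have "\<dots> \<le> t * card X + t * card (C - X)"
          using X(3,4) t0 \<beta>0 V(3) by (intro add_mono mult_mono Q'(1)) auto
        also have "\<dots> = t * card C"
        proof -
          have "card X \<le> card C" by (rule card_mono[OF finC X(2)])
          then have "real (card C) = card X + card (C - X)"
            using X(2) finC by (simp add: card_Diff_subset finite_subset)
          then show ?thesis by (simp add: distrib_left)
        qed
        finally show "card (T \<union> T') * (\<beta> * N) \<le> t * card C \<and> I \<subseteq> C' \<and> C' \<subseteq> V \<and>
            card {e \<in> H. R e \<subseteq> C'} < \<alpha> * N * M" using Q' by blast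
      qed
    qed
  qed
  obtain F G where FG: "local_query F G"
    and res: "\<And>I. I \<subseteq> V \<and> (\<forall>e\<in>H. \<not> R e \<subseteq> I) \<longrightarrow>
      card (F I) * (\<beta> * N) \<le> t * card V \<and> I \<subseteq> G I \<and> G I \<subseteq> V \<and> card {e \<in> H. R e \<subseteq> G I} < \<alpha> * N * M"
    using step[OF order_refl] unfolding queryable_def by blast
  show ?thesis
  proof (rule exI[of _ G], intro allI impI, rule exI)
    fix I assume I: "I \<subseteq> V \<and> (\<forall>e\<in>H. \<not> R e \<subseteq> I)"
    \<comment> \<open>Locality with \<open>J = F I\<close>: the algorithm run on the fingerprint
      returns the same container, so \<open>G\<close> is the required function.\<close>
    have sub: "F I \<subseteq> I" and eq: "G (F I) = G I" using FG unfolding local_query_def by blast+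
    have "card (F I) * \<beta> * N \<le> t * card V" using res[of I] I by (simp add: mult_ac)
    also have "\<dots> \<le> t * N" using t0 V(2) by (rule mult_left_mono[rotated])
    finally have "card (F I) * \<beta> \<le> t" using V(3) by simp
    then show "F I \<subseteq> I \<and> card (F I) * \<beta> \<le> (k - 1) * (\<tau> * N + 1) \<and> I \<subseteq> G (F I) \<and> G (F I) \<subseteq> V \<and>
       card {e \<in> H. R e \<subseteq> G (F I)} < \<alpha> * N * M"
      using res[of I] I sub eq by (simp add: t_def)
  qed
qed

section \<open>Random subsets\<close>

definition rand_weight :: "real \<Rightarrow> 'a set \<Rightarrow> 'a set \<Rightarrow> real" where
  "rand_weight p V S = p ^ card S * (1 - p) ^ card (V - S)"

text \<open>The sum is the expansion of a product over the points of \<open>V\<close>. With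
  \<open>U\<close> empty it is the probability of containing \<open>T\<close>; with
  \<open>x = 1 / 2\<close> it includes an exponential moment of \<open>card (S \<inter> U)\<close>
  and takes the place of a tail bound.\<close>

lemma rand_weight_expectation:
  assumes V: "finite V" and T: "T \<subseteq> V" and U: "U \<subseteq> V" and TU: "T \<inter> U = {}"
  shows "(\<Sum>S\<in>Pow V. rand_weight p V S * (if T \<subseteq> S then x ^ card (S \<inter> U) else 0))
    = p ^ card T * (p * x + (1 - p)) ^ card U"
proof -
  define f1 where "f1 u = p * (if u \<in> U then x else 1)" for u
  define f2 where "f2 u = (if u \<in> T then 0 else 1 - p)" for u
  have "rand_weight p V S * (if T \<subseteq> S then x ^ card (S \<inter> U) else 0) = (\<Prod>u\<in>S. f1 u) * (\<Prod>u\<in>V-S. f2 u)"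
    if S: "S \<in> Pow V" for S
  proof -
    have fin: "finite S" "finite (V - S)" using S V by (auto intro: finite_subset)
    have "(\<Prod>u\<in>S. f1 u) = p ^ card S * (\<Prod>u\<in>S. if u \<in> U then x else 1)"
      by (simp add: f1_def prod.distrib)
    also have "(\<Prod>u\<in>S. if u \<in> U then x else 1) = x ^ card (S \<inter> U)"
      using fin by (simp add: prod.inter_restrict[symmetric])
    finally have 1: "(\<Prod>u\<in>S. f1 u) = p ^ card S * x ^ card (S \<inter> U)" .
    show ?thesis
    proof (cases "T \<subseteq> S")
      case True
      have "(\<Prod>u\<in>V-S. f2 u) = (\<Prod>u\<in>V-S. 1 - p)" by (rule prod.cong) (use True in \<open>auto simp: f2_def\<close>)
      then show ?thesis using 1 True by (simp add: rand_weight_def)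
    next
      case False
      then obtain u where "u \<in> T" "u \<notin> S" by blast
      then have "u \<in> V - S" "f2 u = 0" using T by (auto simp: f2_def)
      then have "(\<Prod>u\<in>V-S. f2 u) = 0" using fin by (intro prod_zero) auto
      then show ?thesis using False by simp
    qed
  qed
  then have "(\<Sum>S\<in>Pow V. rand_weight p V S * (if T \<subseteq> S then x ^ card (S \<inter> U) else 0))
     = (\<Sum>S\<in>Pow V. (\<Prod>u\<in>S. f1 u) * (\<Prod>u\<in>V-S. f2 u))" by (rule sum.cong[OF refl])
  also have "\<dots> = (\<Prod>u\<in>V. f1 u + f2 u)" by (rule prod_add[OF V, symmetric])
  also have "\<dots> = (\<Prod>u\<in>V. (if u \<in> T then p else 1) * (if u \<in> U then p * x + (1 - p) else 1))"
    by (rule prod.cong) (use TU in \<open>auto simp: f1_def f2_def\<close>)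
  also have "\<dots> = (\<Prod>u\<in>V. if u \<in> T then p else 1) * (\<Prod>u\<in>V. if u \<in> U then p * x + (1 - p) else 1)"
    by (rule prod.distrib)
  also have "(\<Prod>u\<in>V. if u \<in> T then p else 1) = p ^ card T"
    using V T by (simp add: prod.inter_restrict[symmetric] Int_absorb1)
  also have "(\<Prod>u\<in>V. if u \<in> U then p * x + (1 - p) else 1) = (p * x + (1 - p)) ^ card U"
    using V U by (simp add: prod.inter_restrict[symmetric] Int_absorb1)
  finally show ?thesis .
qed

lemma rand_weight_supset:
  assumes "finite V" "T \<subseteq> V"
  shows "(\<Sum>S\<in>Pow V. rand_weight p V S * (if T \<subseteq> S then 1 else 0)) = p ^ card T"
  using rand_weight_expectation[OF assms, of "{}" p 1] by (simp cong: if_cong)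

text \<open>Rankin's trick: \<open>y ^ card T / y ^ t\<close> is at least 1 for the sets in
  question, and with this factor inserted the sum may run over all subsets, where it is a product. A
  small \<open>y\<close> tames the exponential at the price of \<open>(1 / y) ^ t\<close>.\<close>

lemma sum_small_subsets_le:
  assumes V: "finite V" and p: "0 \<le> p" and y: "0 < y" "y \<le> (1 :: real)"
  shows "(\<Sum>T | T \<subseteq> V \<and> card T \<le> t. p ^ card T) \<le> (1 / y) ^ t * exp (p * y * card V)"
proof -
  have fin: "finite {T. T \<subseteq> V \<and> card T \<le> t}" using V by simp
  have "(\<Sum>T | T \<subseteq> V \<and> card T \<le> t. p ^ card T) \<le> (\<Sum>T | T \<subseteq> V \<and> card T \<le> t. (1 / y) ^ t * (p * y) ^ card T)"
  proof (rule sum_mono)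
    fix T assume "T \<in> {T. T \<subseteq> V \<and> card T \<le> t}"
    then have "y ^ t \<le> y ^ card T" using y by (intro power_decreasing) auto
    then have "p ^ card T * y ^ t \<le> p ^ card T * y ^ card T" using p by (intro mult_left_mono) auto
    then show "p ^ card T \<le> (1 / y) ^ t * (p * y) ^ card T"
      using y by (simp add: power_divide power_mult_distrib field_simps)
  qed
  also have "\<dots> \<le> (\<Sum>T\<in>Pow V. (1 / y) ^ t * (p * y) ^ card T)"
    using V p y by (intro sum_mono2) auto
  also have "\<dots> = (1 / y) ^ t * (\<Sum>T\<in>Pow V. (\<Prod>u\<in>T. p * y) * (\<Prod>u\<in>V-T. 1))"
    by (simp add: sum_distrib_left)
  also have "(\<Sum>T\<in>Pow V. (\<Prod>u\<in>T. p * y) * (\<Prod>u\<in>V-T. 1)) = (\<Prod>u\<in>V. p * y + 1)"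
    by (rule prod_add[OF V, symmetric])
  also have "\<dots> = (p * y + 1) ^ card V" by simp
  also have "\<dots> \<le> exp (p * y) ^ card V"
    using p y exp_ge_add_one_self[of "p * y"] by (intro power_mono) (auto simp: add.commute)
  also have "\<dots> = exp (p * y * card V)" by (simp add: exp_of_nat_mult[symmetric] mult.commute)
  finally show ?thesis using y by simp
qed

section \<open>Cycles in families of small span\<close>

lemma bad_family_core:
  assumes "finite F" "F \<noteq> {}" "\<And>e. e \<in> F \<Longrightarrow> finite e \<and> card e = k" "1 \<le> k"
    and "card (\<Union>F) \<le> (k - 1) * card F"
  shows "\<exists>F0\<subseteq>F. F0 \<noteq> {} \<and> (\<forall>e\<in>F0. 2 \<le> card (e \<inter> \<Union>(F0 - {e})))"
  using assms
proof (induction "card F" arbitrary: F rule: less_induct)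
  case less
  show ?case
  proof (cases "\<forall>e\<in>F. 2 \<le> card (e \<inter> \<Union>(F - {e}))")
    case False
    then obtain e where e: "e \<in> F" "card (e \<inter> \<Union>(F - {e})) \<le> 1" by force
    let ?F = "F - {e}"
    have fin: "finite e" "finite (\<Union>?F)" "card e = k" using less.prems e(1) by auto
    have U: "\<Union>F = \<Union>?F \<union> e" using e(1) by blast
    have "card (\<Union>?F) + card e = card (\<Union>F) + card (e \<inter> \<Union>?F)"
      unfolding U by (subst card_Un_Int[OF fin(2,1)]) (simp add: Int_commute)
    then have "card (\<Union>?F) + (k - 1) \<le> card (\<Union>F)" using e(2) fin(3) less.prems(4) by linarith
    moreover have cF: "card F = Suc (card ?F)" using card_Suc_Diff1[OF less.prems(1) e(1)] by simp
    ultimately have small: "card (\<Union>?F) \<le> (k - 1) * card ?F" using less.prems(5) by simp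
    have "?F \<noteq> {}"
    proof
      assume "?F = {}"
      then have "card ?F = 0" by (simp only: card.empty)
      moreover have "\<Union>F = e" using U \<open>?F = {}\<close> by (simp only: Union_empty Un_empty_left)
      ultimately have "\<Union>F = e" "card F = 1" using cF by simp_all
      then show False using fin(3) less.prems(4,5) by simp
    qed
    then have "\<exists>F0\<subseteq>?F. F0 \<noteq> {} \<and> (\<forall>e\<in>F0. 2 \<le> card (e \<inter> \<Union>(F0 - {e})))"
      using less.hyps[of ?F] less.prems small cF by simp
    then show ?thesis by blast
  qed (use less.prems in blast)
qed

text \<open>Neither \<open>u\<close> nor \<open>f\<close> has to be injective. Distinct consecutive
  junctions suffice for counting, since two points and their positions determine a
  progression.\<close>

definition cyclic_chain :: "'a set set \<Rightarrow> nat \<Rightarrow> (nat \<Rightarrow> 'a) \<Rightarrow> (nat \<Rightarrow> 'a set) \<Rightarrow> bool" where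
  "cyclic_chain F L u f \<longleftrightarrow> (\<forall>m<L. f m \<in> F \<and> u m \<in> f m \<and> u (Suc m mod L) \<in> f m \<and> u m \<noteq> u (Suc m mod L))"

text \<open>A walk that leaves each edge at a point other than its entry, into a different edge,
  must return by finiteness. At the shortest return the edges form a path in which only neighbours
  meet, plus a closing edge. Along the path each further edge adds \<open>k - 1\<close> points, the
  closing one only \<open>k - 2\<close>; this makes the size exactly
  \<open>(k - 1) * L\<close>.\<close>

lemma linear_core_has_cycle:
  assumes F: "finite F" "F \<noteq> {}" "\<And>e. e \<in> F \<Longrightarrow> finite e \<and> card e = k" "1 \<le> k"
    and core: "\<And>e. e \<in> F \<Longrightarrow> 2 \<le> card (e \<inter> \<Union>(F - {e}))"
    and linear: "\<And>e e' x y. e \<in> F \<Longrightarrow> e' \<in> F \<Longrightarrow> e \<noteq> e' \<Longrightarrow> x \<in> e \<inter> e' \<Longrightarrow> y \<in> e \<inter> e' \<Longrightarrow> x = y"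
  shows "\<exists>L u f. cyclic_chain F L u f \<and> 3 \<le> L \<and> L \<le> card F \<and> card (\<Union>m<L. f m) = (k - 1) * L"
proof -
  have "\<exists>q. \<forall>n. (snd (q n) \<in> F \<and> fst (q n) \<in> snd (q n)) \<and>
     (fst (q (Suc n)) \<in> snd (q n) \<and> fst (q (Suc n)) \<noteq> fst (q n) \<and> snd (q (Suc n)) \<noteq> snd (q n))"
  proof (rule dependent_nat_choice)
    obtain e where e: "e \<in> F" using F(2) by blast
    then have "e \<noteq> {}" using F(3)[OF e] F(4) by auto
    then show "\<exists>q. snd q \<in> F \<and> fst q \<in> snd q" using e by auto
  next
    fix q :: "'a \<times> 'a set" and n :: nat
    assume q: "snd q \<in> F \<and> fst q \<in> snd q"
    let ?Z = "snd q \<inter> \<Union>(F - {snd q})"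
    have "\<not> ?Z \<subseteq> {fst q}"
    proof
      assume "?Z \<subseteq> {fst q}"
      then have "card ?Z \<le> 1" using card_mono[of "{fst q}" ?Z] by simp
      then show False using core[of "snd q"] q by simp
    qed
    then obtain v' e' where "v' \<in> snd q" "v' \<noteq> fst q" "e' \<in> F" "e' \<noteq> snd q" "v' \<in> e'" by blast
    then show "\<exists>q'. (snd q' \<in> F \<and> fst q' \<in> snd q') \<and>
       (fst q' \<in> snd q \<and> fst q' \<noteq> fst q \<and> snd q' \<noteq> snd q)"
      by (intro exI[of _ "(v', e')"]) simp
  qed
  then obtain q where q: "\<forall>n. (snd (q n) \<in> F \<and> fst (q n) \<in> snd (q n)) \<and>
     (fst (q (Suc n)) \<in> snd (q n) \<and> fst (q (Suc n)) \<noteq> fst (q n) \<and> snd (q (Suc n)) \<noteq> snd (q n))" by blast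
  define v e where "v n = fst (q n)" and "e n = snd (q n)" for n
  have eF: "e n \<in> F" and ve: "v n \<in> e n" and ve': "v (Suc n) \<in> e n"
    and vne: "v (Suc n) \<noteq> v n" and ene: "e (Suc n) \<noteq> e n" for n
    using q by (auto simp: v_def e_def)
  have adj: "e n \<inter> e (Suc n) = {v (Suc n)}" for n
    using linear[OF eF eF ene[of n, symmetric]] ve[of "Suc n"] ve'[of n] by blast
  define P where "P d \<longleftrightarrow> 2 \<le> d \<and> (\<exists>i. e i \<inter> e (i + d) \<noteq> {})" for d
  have "\<exists>d. P d"
  proof -
    have "\<not> inj e"
    proof
      assume "inj e"
      moreover have "range e \<subseteq> F" using eF by blast
      ultimately show False using F(1) finite_subset infinite_UNIV_nat finite_imageD by blast
    qed
    then obtain i j where ij: "i < j" "e i = e j" unfolding inj_def by (metis linorder_neqE_nat)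
    then have "j \<noteq> Suc i" using ene[of i] by auto
    then have "P (j - i)" unfolding P_def using ij ve[of i] by (auto intro!: exI[of _ i])
    then show ?thesis ..
  qed
  then obtain d where d: "P d" "\<And>d'. d' < d \<Longrightarrow> \<not> P d'" using exists_least_iff[of P] by blast
  then obtain i w where d2: "2 \<le> d" and w: "w \<in> e i" "w \<in> e (i + d)" unfolding P_def by blast
  have apart: "e n \<inter> e m = {}" if "n + 2 \<le> m" "m < n + d" for n m
  proof -
    have "\<not> P (m - n)" using that by (intro d(2)) auto
    moreover have "2 \<le> m - n" "n + (m - n) = m" using that by auto
    ultimately show ?thesis unfolding P_def by metis
  qed
  have pred: "e (i + (d - 1)) \<inter> e (i + d) = {v (i + d)}"
    using adj[of "i + (d - 1)"] d2 by simp
  have ends_ne: "e i \<noteq> e (i + d)"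
  proof
    assume eq: "e i = e (i + d)"
    show False
    proof (cases "d = 2")
      case True
      then have "v (Suc (Suc i)) \<in> e i \<inter> e (Suc i)" using eq ve[of "Suc (Suc i)"] ve'[of "Suc i"] by simp
      then show False using adj[of i] vne[of "Suc i"] by simp
    next
      case False
      then have "e i \<inter> e (i + (d - 1)) = {}" using d2 by (intro apart) auto
      then show False using pred eq by blast
    qed
  qed
  \<comment> \<open>The closing point must differ from both adjacent junctions. Otherwise two edges
    at distance \<open>d - 1\<close> would meet, against minimality; for \<open>d = 2\<close> they
    are neighbours with only one common point.\<close>
  have w_last: "w \<noteq> v (i + d)"
  proof
    assume eq: "w = v (i + d)"
    then have w': "w \<in> e (i + (d - 1))" using pred by blast
    show False
    proof (cases "d = 2")
      case True
      then have "w \<in> e i \<inter> e (Suc i)" using w w' by simp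
      then have "w = v (Suc i)" using adj by simp
      then show False using eq vne[of "Suc i"] True by simp
    next
      case False
      then have "e i \<inter> e (i + (d - 1)) = {}" using d2 by (intro apart) auto
      then show False using w w' by blast
    qed
  qed
  have w_first: "w \<noteq> v (Suc i)"
  proof
    assume eq: "w = v (Suc i)"
    then have w': "w \<in> e (Suc i)" using ve by simp
    show False
    proof (cases "d = 2")
      case True
      then have "w \<in> e (Suc i) \<inter> e (Suc (Suc i))" using w w' by simp
      then have "w = v (Suc (Suc i))" using adj by simp
      then show False using w_last True by simp
    next
      case False
      then have "e (Suc i) \<inter> e (i + d) = {}" using d2 by (intro apart) auto
      then show False using w w' by blast
    qed
  qed
  have ends: "e i \<inter> e (i + d) = {w}" using linear[OF eF eF ends_ne] w by blast
  define f where "f m = e (i + m)" for m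
  define u where "u m = (if m = 0 then w else v (i + m))" for m
  have fin: "finite (f m)" "card (f m) = k" for m using F(3)[OF eF] by (auto simp: f_def)
  have card_Un: "card (\<Union>m<Suc n. f m) + card (f n \<inter> (\<Union>m<n. f m)) = card (\<Union>m<n. f m) + k" for n
    using card_Un_Int[of "\<Union>m<n. f m" "f n"] fin by (simp add: lessThan_Suc Int_commute Un_commute)
  have path: "card (\<Union>m<n. f m) = (k - 1) * n + 1" if "1 \<le> n" "n \<le> d" for n
    using that
  proof (induction n rule: nat_induct_at_least)
    case base
    then show ?case using fin F(4) by (simp add: lessThan_Suc)
  next
    case (Suc n)
    have "f n \<inter> f m = (if Suc m = n then {v (i + n)} else {})" if "m < n" for m
    proof (cases "Suc m = n")
      case True
      have "e (i + m) \<inter> e (i + n) = {v (i + n)}" using adj[of "i + m"] by (simp add: True[symmetric])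
      then show ?thesis using True by (simp add: f_def Int_commute)
    next
      case False
      have "e (i + m) \<inter> e (i + n) = {}" using False that Suc.prems by (intro apart) auto
      then show ?thesis using False by (simp add: f_def Int_commute)
    qed
    then have "(\<Union>m<n. f n \<inter> f m) = (\<Union>m<n. if Suc m = n then {v (i + n)} else {})"
      by (intro SUP_cong) auto
    then have "f n \<inter> (\<Union>m<n. f m) = (\<Union>m<n. if Suc m = n then {v (i + n)} else {})"
      by (simp only: Int_UN_distrib)
    also have "\<dots> = {v (i + n)}"
    proof -
      have "n - 1 < n" "Suc (n - 1) = n" using Suc.hyps by auto
      then show ?thesis by (fastforce split: if_splits)
    qed
    finally have "f n \<inter> (\<Union>m<n. f m) = {v (i + n)}" .
    then have "card (\<Union>m<Suc n. f m) + 1 = card (\<Union>m<n. f m) + k" using card_Un[of n] by simp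
    then show ?case using Suc.IH Suc.prems F(4) by (cases k) simp_all
  qed
  have "f d \<inter> (\<Union>m<d. f m) = {v (i + d), w}"
  proof
    show "f d \<inter> (\<Union>m<d. f m) \<subseteq> {v (i + d), w}"
    proof
      fix x assume "x \<in> f d \<inter> (\<Union>m<d. f m)"
      then obtain m where m: "m < d" "x \<in> e (i + m)" "x \<in> e (i + d)" by (auto simp: f_def)
      consider "m = 0" | "m = d - 1" | "0 < m" "m + 2 \<le> d" using m(1) by linarith
      then show "x \<in> {v (i + d), w}"
      proof cases
        case 1
        then show ?thesis using m ends by auto
      next
        case 2
        then show ?thesis using m pred by auto
      next
        case 3
        then have "e (i + m) \<inter> e (i + d) = {}" by (intro apart) auto
        then show ?thesis using m by blast
      qed
    qed
    have "v (i + d) \<in> f (d - 1)" "w \<in> f 0" "d - 1 < d" "0 < d" using pred w d2 by (auto simp: f_def)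
    then have "v (i + d) \<in> (\<Union>m<d. f m)" "w \<in> (\<Union>m<d. f m)" by blast+
    moreover have "v (i + d) \<in> f d" "w \<in> f d" using w ve by (simp_all add: f_def)
    ultimately show "{v (i + d), w} \<subseteq> f d \<inter> (\<Union>m<d. f m)" by blast
  qed
  then have "card (\<Union>m<Suc d. f m) + 2 = card (\<Union>m<d. f m) + k" using card_Un[of d] w_last by simp
  moreover have "card (\<Union>m<d. f m) = (k - 1) * d + 1" using d2 by (intro path) auto
  ultimately have card_cycle: "card (\<Union>m<Suc d. f m) = (k - 1) * Suc d" using F(4) by (cases k) simp_all
  have f_ne: "f n \<noteq> f m" if "n < m" "m \<le> d" for n m
  proof -
    consider "m = Suc n" | "n + 2 \<le> m" "m < n + d" | "n = 0" "m = d" using \<open>n < m\<close> \<open>m \<le> d\<close> by linarith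
    then show ?thesis
    proof cases
      case 1
      then show ?thesis using ene[of "i + n"] by (auto simp: f_def)
    next
      case 2
      then have "e (i + n) \<inter> e (i + m) = {}" by (intro apart) auto
      then show ?thesis using ve[of "i + n"] by (auto simp: f_def)
    next
      case 3
      then show ?thesis using ends_ne by (simp add: f_def)
    qed
  qed
  have "inj_on f {..<Suc d}"
    by (rule inj_onI) (metis f_ne less_Suc_eq_le lessThan_iff linorder_neqE_nat)
  moreover have "f ` {..<Suc d} \<subseteq> F" using eF by (auto simp: f_def)
  ultimately have "Suc d \<le> card F" using card_inj_on_le[OF _ _ F(1)] by (metis card_lessThan)
  moreover have "cyclic_chain F (Suc d) u f" unfolding cyclic_chain_def
  proof (intro allI impI)
    fix m assume m: "m < Suc d"
    show "f m \<in> F \<and> u m \<in> f m \<and> u (Suc m mod Suc d) \<in> f m \<and> u m \<noteq> u (Suc m mod Suc d)"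
    proof (cases "m = d")
      case True
      then show ?thesis using eF ve[of "i + d"] w w_last d2 by (auto simp: u_def f_def)
    next
      case False
      then have "Suc m mod Suc d = Suc m" using m by simp
      then show ?thesis using eF ve[of "i + m"] ve'[of "i + m"] vne[of "i + m"] w w_first
        by (auto simp: u_def f_def)
    qed
  qed
  ultimately show ?thesis using card_cycle d2 by (intro exI[of _ "Suc d"] exI[of _ u] exI[of _ f]) simp
qed

text \<open>In the core either two edges share two points, which is a cycle of length 2, or the core
  is linear. The sizes of the unions become exponents of \<open>p\<close> in the expected counts,
  and \<open>L \<le> card F\<close> ensures \<open>L < g\<close>.\<close>

lemma bad_family_has_cycle:
  assumes F: "finite F" "F \<noteq> {}" "\<And>e. e \<in> F \<Longrightarrow> finite e \<and> card e = k" "1 \<le> k"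
    and bad: "card (\<Union>F) \<le> (k - 1) * card F"
  shows "\<exists>L u f. cyclic_chain F L u f \<and>
    (L = 2 \<and> k + 1 \<le> card (\<Union>m<L. f m) \<or> 3 \<le> L \<and> L \<le> card F \<and> card (\<Union>m<L. f m) = (k - 1) * L)"
proof -
  obtain F0 where F0: "F0 \<subseteq> F" "F0 \<noteq> {}" "\<And>e. e \<in> F0 \<Longrightarrow> 2 \<le> card (e \<inter> \<Union>(F0 - {e}))"
    using bad_family_core[OF F bad] by blast
  show ?thesis
  proof (cases "\<exists>e\<in>F0. \<exists>e'\<in>F0. \<exists>x\<in>e \<inter> e'. \<exists>y\<in>e \<inter> e'. e \<noteq> e' \<and> x \<noteq> y")
    case True
    then obtain e e' x y where e: "e \<in> F" "e' \<in> F" "e \<noteq> e'" "x \<in> e \<inter> e'" "y \<in> e \<inter> e'" "x \<noteq> y"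
      using F0(1) by blast
    let ?u = "\<lambda>m::nat. if m = 0 then x else y" and ?f = "\<lambda>m::nat. if m = 0 then e else e'"
    have U: "(\<Union>m<2. ?f m) = e \<union> e'" by (auto simp: lessThan_Suc numeral_2_eq_2)
    have "e \<subset> e \<union> e'"
    proof -
      have "\<not> e' \<subseteq> e" using F(3)[OF e(1)] F(3)[OF e(2)] e(3) card_subset_eq by metis
      then show ?thesis by blast
    qed
    then have "k + 1 \<le> card (e \<union> e')" using psubset_card_mono[of "e \<union> e'" e] F(3) e by auto
    moreover have "cyclic_chain F 2 ?u ?f"
      unfolding cyclic_chain_def using e by (auto simp: less_2_cases_iff)
    ultimately show ?thesis using U by (intro exI[of _ 2] exI[of _ ?u] exI[of _ ?f]) simp
  next
    case False
    have "\<exists>L u f. cyclic_chain F0 L u f \<and> 3 \<le> L \<and> L \<le> card F0 \<and> card (\<Union>m<L. f m) = (k - 1) * L"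
    proof (rule linear_core_has_cycle)
      show "finite F0" using F0(1) F(1) by (rule finite_subset)
    qed (use F0 F False in blast)+
    then obtain L u f where "cyclic_chain F0 L u f" "3 \<le> L" "L \<le> card F0" "card (\<Union>m<L. f m) = (k - 1) * L"
      by blast
    moreover have "card F0 \<le> card F" using F0(1) F(1) by (simp add: card_mono)
    ultimately show ?thesis using F0(1) unfolding cyclic_chain_def
      by (intro exI[of _ L] exI[of _ u] exI[of _ f]) auto
  qed
qed

section \<open>The hypergraph of arithmetic progressions\<close>

lemma finite_AP [simp]: "finite (AP k l)" by (simp add: AP_def)

lemma AP_mem: "i < k \<Longrightarrow> a + i * d \<in> AP k (a, d)" by (auto simp: AP_def)

lemma card_AP:
  assumes "0 < d"
  shows "card (AP k (a, d)) = k"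
  using assms unfolding AP_def by (subst card_image) (auto simp: inj_on_def)

definition AP_labels :: "nat \<Rightarrow> nat set \<Rightarrow> (nat \<times> nat) set" where
  "AP_labels k V = {l. 0 < snd l \<and> AP k l \<subseteq> V}"

lemma AP_labels_subset:
  assumes "2 \<le> k" "V \<subseteq> {1..N}"
  shows "AP_labels k V \<subseteq> {1..N} \<times> {1..N}"
proof
  fix l assume l: "l \<in> AP_labels k V"
  obtain a d where ad: "l = (a, d)" by (cases l)
  have "a + 0 * d \<in> AP k l" "a + 1 * d \<in> AP k l" unfolding ad by (rule AP_mem, use assms(1) in simp)+
  then have "a \<in> {1..N}" "a + d \<in> {1..N}" "0 < d" using l assms(2) by (auto simp: AP_labels_def ad)
  then show "l \<in> {1..N} \<times> {1..N}" by (auto simp: ad)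
qed

lemma finite_AP_labels:
  assumes "2 \<le> k" "V \<subseteq> {1..N}"
  shows "finite (AP_labels k V)"
  using AP_labels_subset[OF assms] by (rule finite_subset) simp

text \<open>The label whose terms number \<open>a\<close> and \<open>b\<close> are \<open>u\<close>
  and \<open>w\<close>. The computation is in the integers because \<open>b < a\<close> is
  possible.\<close>

definition AP_through :: "nat \<Rightarrow> nat \<Rightarrow> nat \<Rightarrow> nat \<Rightarrow> nat \<times> nat" where
  "AP_through u w a b = (let d = nat ((int w - int u) div (int b - int a)) in (u - a * d, d))"

lemma AP_through_eq:
  assumes "u = x + a * d" "w = x + b * d" "u \<noteq> w"
  shows "AP_through u w a b = (x, d)"
proof -
  have "int w - int u = int d * (int b - int a)" using assms(1,2) by (simp add: algebra_simps)
  moreover have "int b - int a \<noteq> 0" using assms by auto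
  ultimately have "nat ((int w - int u) div (int b - int a)) = d" by simp
  then show ?thesis using assms(1) by (simp add: AP_through_def)
qed

lemma AP_through_cover:
  assumes "u \<in> AP k l" "w \<in> AP k l" "u \<noteq> w"
  shows "\<exists>a<k. \<exists>b<k. l = AP_through u w a b"
proof -
  obtain x d where l: "l = (x, d)" by (cases l)
  then obtain a b where "a < k" "b < k" "u = x + a * d" "w = x + b * d" using assms by (auto simp: AP_def)
  then show ?thesis using AP_through_eq assms(3) l by metis
qed

lemma AP_codegree:
  assumes "u \<noteq> w"
  shows "card {l \<in> AP_labels k V. u \<in> AP k l \<and> w \<in> AP k l} \<le> k\<^sup>2"
proof -
  have "{l \<in> AP_labels k V. u \<in> AP k l \<and> w \<in> AP k l} \<subseteq> (\<lambda>(a, b). AP_through u w a b) ` ({..<k} \<times> {..<k})"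
    using AP_through_cover[OF _ _ assms] by fastforce
  then have "card {l \<in> AP_labels k V. u \<in> AP k l \<and> w \<in> AP k l} \<le> card ({..<k} \<times> {..<k})"
    by (meson card_image_le card_mono finite_SigmaI finite_imageI finite_lessThan le_trans)
  then show ?thesis by (simp add: power2_eq_square)
qed

lemma AP_degree:
  assumes "2 \<le> k" "V \<subseteq> {1..N}"
  shows "card {l \<in> AP_labels k V. u \<in> AP k l} \<le> k * N"
proof -
  have "{l \<in> AP_labels k V. u \<in> AP k l} \<subseteq> (\<lambda>(i, d). (u - i * d, d)) ` ({..<k} \<times> {1..N})"
  proof
    fix l assume l: "l \<in> {l \<in> AP_labels k V. u \<in> AP k l}"
    obtain a d where ad: "l = (a, d)" by (cases l)
    obtain i where "i < k" "u = a + i * d" using l by (auto simp: AP_def ad)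
    moreover have "d \<in> {1..N}" using l AP_labels_subset[OF assms] by (auto simp: ad)
    ultimately show "l \<in> (\<lambda>(i, d). (u - i * d, d)) ` ({..<k} \<times> {1..N})"
      by (intro image_eqI[of _ _ "(i, d)"]) (auto simp: ad)
  qed
  then have "card {l \<in> AP_labels k V. u \<in> AP k l} \<le> card ({..<k} \<times> {1..N})"
    by (meson card_image_le card_mono finite_SigmaI finite_imageI finite_lessThan finite_atLeastAtMost le_trans)
  then show ?thesis by simp
qed

section \<open>Counting cycles of progressions\<close>

definition cycle_supports :: "nat \<Rightarrow> nat set \<Rightarrow> nat \<Rightarrow> nat set set" where
  "cycle_supports k V L = {Q. \<exists>u f. cyclic_chain {e. e \<subseteq> V \<and> is_AP k e} L u f \<and> Q = (\<Union>m<L. f m)}"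

text \<open>A chain is encoded by its junctions and the positions of the two junctions in each edge:
  \<open>card V * k^2\<close> choices per step. Unions are counted instead of chains, since survival
  in a random set depends on the union only.\<close>

lemma card_cycle_supports:
  assumes "finite V"
  shows "finite (cycle_supports k V L)" "card (cycle_supports k V L) \<le> (card V * k\<^sup>2) ^ L"
proof -
  let ?code = "\<lambda>c. \<Union>m<L. AP k (AP_through (fst (c m)) (fst (c (Suc m mod L))) (fst (snd (c m))) (snd (snd (c m))))"
  let ?C = "PiE {..<L} (\<lambda>_. V \<times> {..<k} \<times> {..<k})"
  have "cycle_supports k V L \<subseteq> ?code ` ?C"
  proof
    fix Q assume "Q \<in> cycle_supports k V L"
    then obtain u f where Q: "Q = (\<Union>m<L. f m)"
      and f: "\<And>m. m < L \<Longrightarrow> f m \<subseteq> V \<and> is_AP k (f m)"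
      "\<And>m. m < L \<Longrightarrow> u m \<in> f m \<and> u (Suc m mod L) \<in> f m \<and> u m \<noteq> u (Suc m mod L)"
      unfolding cycle_supports_def cyclic_chain_def by blast
    have "\<exists>ab. fst ab < k \<and> snd ab < k \<and> f m = AP k (AP_through (u m) (u (Suc m mod L)) (fst ab) (snd ab))"
      if m: "m < L" for m
    proof -
      obtain a d where "f m = AP k (a, d)" using f(1)[OF m] by (auto simp: is_AP_iff)
      moreover obtain i j where "i < k" "j < k" "(a, d) = AP_through (u m) (u (Suc m mod L)) i j"
        using AP_through_cover[of "u m" k "(a, d)" "u (Suc m mod L)"] f(2)[OF m] calculation by auto
      ultimately show ?thesis by (intro exI[of _ "(i, j)"]) simp
    qed
    then obtain ab where ab: "\<And>m. m < L \<Longrightarrow> fst (ab m) < k \<and> snd (ab m) < k \<and>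
        f m = AP k (AP_through (u m) (u (Suc m mod L)) (fst (ab m)) (snd (ab m)))" by metis
    define c where "c = restrict (\<lambda>m. (u m, ab m)) {..<L}"
    have "c \<in> ?C"
      unfolding c_def
    proof (rule restrict_PiE_iff[THEN iffD2], rule ballI)
      fix m assume "m \<in> {..<L}"
      then show "(u m, ab m) \<in> V \<times> {..<k} \<times> {..<k}" using f[of m] ab[of m] by (auto simp: mem_Times_iff)
    qed
    moreover have "Q = ?code c" unfolding Q
    proof (rule SUP_cong)
      fix m assume m: "m \<in> {..<L}"
      then have "Suc m mod L < L" by auto
      then show "f m = AP k (AP_through (fst (c m)) (fst (c (Suc m mod L))) (fst (snd (c m))) (snd (snd (c m))))"
        using ab[of m] m by (simp add: c_def)
    qed simp
    ultimately show "Q \<in> ?code ` ?C" by blast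
  qed
  moreover have fin: "finite ?C" using assms by (intro finite_PiE) auto
  ultimately have "card (cycle_supports k V L) \<le> card ?C" "finite (cycle_supports k V L)"
    by (meson card_image_le card_mono finite_imageI le_trans finite_subset)+
  moreover have "card ?C = (card V * k\<^sup>2) ^ L"
    by (simp add: card_PiE card_cartesian_product power2_eq_square)
  ultimately show "finite (cycle_supports k V L)" "card (cycle_supports k V L) \<le> (card V * k\<^sup>2) ^ L" by auto
qed

text \<open>Chains may repeat edges; the size conditions exclude those that stay within one
  progression.\<close>

definition short_cycles :: "nat \<Rightarrow> nat \<Rightarrow> nat set \<Rightarrow> nat set set" where
  "short_cycles k g V = {Q \<in> cycle_supports k V 2. k + 1 \<le> card Q} \<union>
     (\<Union>L\<in>{3..<g}. {Q \<in> cycle_supports k V L. card Q = (k - 1) * L})"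

lemma girth_at_least_AP:
  assumes "1 \<le> k" "S \<subseteq> V" and no: "\<And>Q. Q \<in> short_cycles k g V \<Longrightarrow> \<not> Q \<subseteq> S"
  shows "girth_at_least k (AP_hypergraph k S) g"
  unfolding girth_at_least_def
proof (intro conjI allI impI)
  have AP: "finite e \<and> card e = k" if "is_AP k e" for e
    using that card_AP by (auto simp: is_AP_iff)
  then show "uniform_hypergraph k (AP_hypergraph k S)"
    by (auto simp: uniform_hypergraph_def AP_hypergraph_def)
  fix h F assume h: "2 \<le> h \<and> h < g" and F: "F \<subseteq> snd (AP_hypergraph k S) \<and> finite F \<and> card F = h"
  show "(k - 1) * h + 1 \<le> card (\<Union>F)"
  proof (rule ccontr)
    assume "\<not> ?thesis"
    then have bad: "card (\<Union>F) \<le> (k - 1) * card F" using F by simp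
    have FS: "F \<subseteq> {e. e \<subseteq> S \<and> is_AP k e}" using F by (simp add: AP_hypergraph_def)
    have "F \<noteq> {}" using h F by auto
    then obtain L u f where c: "cyclic_chain F L u f"
      and L: "L = 2 \<and> k + 1 \<le> card (\<Union>m<L. f m) \<or> 3 \<le> L \<and> L \<le> card F \<and> card (\<Union>m<L. f m) = (k - 1) * L"
      using bad_family_has_cycle[of F k] AP FS F assms(1) bad by blast
    have "cyclic_chain {e. e \<subseteq> V \<and> is_AP k e} L u f"
      using c FS assms(2) unfolding cyclic_chain_def by blast
    then have "(\<Union>m<L. f m) \<in> cycle_supports k V L" unfolding cycle_supports_def by blast
    then have "(\<Union>m<L. f m) \<in> short_cycles k g V"
      using L h F unfolding short_cycles_def by auto
    moreover have "(\<Union>m<L. f m) \<subseteq> S" using c FS unfolding cyclic_chain_def by blast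
    ultimately show False using no by blast
  qed
qed

text \<open>For \<open>N = k * W * q\<close>, every pair in \<open>A\<close> is the start and step
  of a dilated copy of \<open>{1..W}\<close> inside \<open>{1..N}\<close>, and each copy contains a
  monochromatic progression by the choice of \<open>W\<close>. One progression serves at most
  \<open>W^2\<close> copies: its first position \<open>x\<close> and difference \<open>y\<close>
  within the copy determine the copy.\<close>

lemma AP_supersaturation:
  fixes k r N W :: nat
  assumes k: "2 \<le> k" and r: "0 < r" and W: "W = vdW k r" and N: "k * W dvd N"
    and c: "c ` {1..N} \<subseteq> {..<r}"
  shows "N\<^sup>2 \<le> 2 * k * W ^ 3 * card {l \<in> AP_labels k {1..N}. monochromatic c (AP k l)}"
proof -
  let ?M = "{l \<in> AP_labels k {1..N}. monochromatic c (AP k l)}"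
  have W0: "0 < W" using colours_less_vdW[OF k r] W by simp
  obtain q where q: "N = k * W * q" using N by (auto simp: dvd_def)
  define A where "A = {1..(k - 1) * W * q} \<times> {1..q}"
  have "A \<subseteq> (\<lambda>(l, x, y). (fst l - x * (snd l div y), snd l div y)) ` (?M \<times> {..<W} \<times> {1..W})"
  proof
    fix z assume z: "z \<in> A"
    obtain a d where ad: "z = (a, d)" by (cases z)
    have a: "1 \<le> a" "a \<le> (k - 1) * W * q" and d: "1 \<le> d" "d \<le> q" using z by (auto simp: A_def ad)
    have le: "a + x * d \<le> N" if "x \<le> W" for x
    proof -
      have "x * d \<le> W * q" using that d(2) by (rule mult_le_mono)
      moreover have "N = (k - 1) * W * q + W * q" using k by (simp add: q algebra_simps flip: add_mult_distrib)
      ultimately show ?thesis using a(2) by linarith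
    qed
    define c' where "c' x = c (a + (x - 1) * d)" for x
    have "c' ` {1..W} \<subseteq> {..<r}"
    proof (rule image_subsetI)
      fix x assume "x \<in> {1..W}"
      then have "a + (x - 1) * d \<in> {1..N}" using le[of "x - 1"] a(1) by auto
      then show "c' x \<in> {..<r}" using c unfolding c'_def by blast
    qed
    then obtain e where e: "e \<subseteq> {1..W}" "is_AP k e" "monochromatic c' e"
      using van_der_Waerden[OF r, of k] W by blast
    then obtain x y where xy: "0 < y" "e = AP k (x, y)" by (auto simp: is_AP_iff)
    have mem: "x + i * y \<in> {1..W}" if "i < k" for i using AP_mem[OF that] e(1) xy(2) by blast
    have x: "1 \<le> x" "x \<le> W" "y \<le> W" using mem[of 0] mem[of 1] k by auto
    let ?l = "(a + (x - 1) * d, y * d)"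
    have pos: "a + (x - 1) * d + i * (y * d) = a + (x + i * y - 1) * d" for i
      using x(1) by (cases x) (simp_all add: algebra_simps)
    have "AP k ?l \<subseteq> {1..N}"
    proof
      fix w assume "w \<in> AP k ?l"
      then obtain i where i: "i < k" "w = a + (x + i * y - 1) * d" using pos by (auto simp: AP_def)
      then show "w \<in> {1..N}" using le[of "x + i * y - 1"] mem[OF i(1)] a(1) by auto
    qed
    moreover have "monochromatic c (AP k ?l)"
    proof -
      obtain j where j: "\<forall>w\<in>e. c' w = j" using e(3) unfolding monochromatic_def by blast
      have "c (a + (x - 1) * d + i * (y * d)) = j" if "i < k" for i
        using j AP_mem[OF that, of x y] xy(2) unfolding pos c'_def by auto
      then show ?thesis unfolding monochromatic_def AP_def by auto
    qed
    moreover have "0 < y * d" using xy(1) d(1) by simp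
    ultimately have "?l \<in> ?M" by (simp add: AP_labels_def)
    moreover have "x - 1 \<in> {..<W}" "y \<in> {1..W}" using x xy(1) by auto
    moreover have "y * d div y = d" using xy(1) by simp
    ultimately show "z \<in> (\<lambda>(l, x, y). (fst l - x * (snd l div y), snd l div y)) ` (?M \<times> {..<W} \<times> {1..W})"
      by (intro image_eqI[of _ _ "(?l, x - 1, y)"]) (simp_all add: ad)
  qed
  moreover have "finite (?M \<times> {..<W} \<times> {1..W})" using finite_AP_labels[OF k order_refl] by simp
  ultimately have "card A \<le> card (?M \<times> {..<W} \<times> {1..W})"
    by (meson card_image_le card_mono finite_imageI le_trans)
  then have A: "(k - 1) * W * q * q \<le> card ?M * W\<^sup>2"
    by (simp add: A_def card_cartesian_product power2_eq_square mult_ac)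
  have "N\<^sup>2 = k * (k * W * q * q) * W" by (simp add: q power2_eq_square mult_ac)
  also have "\<dots> \<le> k * (2 * ((k - 1) * W * q * q)) * W"
  proof -
    have "k * (W * q * q) \<le> 2 * (k - 1) * (W * q * q)" using k by (intro mult_le_mono) auto
    then have "k * W * q * q \<le> 2 * ((k - 1) * W * q * q)" by (simp add: mult_ac)
    then show ?thesis by (rule mult_le_mono[OF mult_le_mono[OF order_refl] order_refl])
  qed
  also have "\<dots> \<le> k * (2 * (card ?M * W\<^sup>2)) * W" by (rule mult_le_mono[OF mult_le_mono[OF order_refl mult_le_mono[OF order_refl A]] order_refl])
  also have "\<dots> = 2 * k * W ^ 3 * card ?M" by (simp add: power2_eq_square power3_eq_cube)
  finally show ?thesis .
qed

section \<open>Sparse random sets of integers\<close>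

text \<open>A colouring of \<open>S0 - Z\<close> into independent classes yields fingerprints
  \<open>T i\<close> of its classes. All of \<open>S0\<close> outside their containers must have
  been deleted, so \<open>S0\<close> has at most \<open>m\<close> points in \<open>U T\<close>,
  although that set is large. The expected weight of such an event, summed over all tuples, is too
  small.\<close>

lemma random_subset_exists:
  fixes f :: "'a set \<Rightarrow> 'a set" and p :: real and r t u m :: nat
  assumes V: "finite V" and p: "0 \<le> p" "p \<le> 1"
    and Qs: "finite Qs" "\<And>Q. Q \<in> Qs \<Longrightarrow> Q \<subseteq> V \<and> Q \<noteq> {}"
    and container: "\<And>I. I \<subseteq> V \<Longrightarrow> indep I \<Longrightarrow> \<exists>T\<subseteq>I. card T \<le> t \<and> I \<subseteq> f T \<and> f T \<subseteq> V \<and> small (f T)"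
    and cover: "\<And>C. (\<And>i. i < r \<Longrightarrow> C i \<subseteq> V \<and> small (C i)) \<Longrightarrow> u \<le> card (V - (\<Union>i<r. C i))"
    and few_Qs: "2 * (\<Sum>Q\<in>Qs. p ^ card Q) < m"
    and few_colourings: "2 ^ m * (\<Sum>T | T \<subseteq> V \<and> card T \<le> t. p ^ card T) ^ r * (1 - p / 2) ^ u \<le> 1 / 2"
  shows "\<exists>S\<subseteq>V. (\<forall>Q\<in>Qs. \<not> Q \<subseteq> S) \<and> \<not> (\<exists>c. c ` S \<subseteq> {..<r} \<and> (\<forall>i<r. indep {x \<in> S. c x = i}))"
proof -
  let ?B = "{T. T \<subseteq> V \<and> card T \<le> t}"
  define PP where "PP = PiE {..<r} (\<lambda>_. ?B)"
  define TT where "TT = {T \<in> PP. (\<forall>i<r. f (T i) \<subseteq> V \<and> small (f (T i)) \<and> T i \<subseteq> f (T i)) \<and>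
     (\<forall>i<r. \<forall>j<r. i \<noteq> j \<longrightarrow> T i \<inter> T j = {})}"
  define U where "U T = V - (\<Union>i<r. f (T i))" for T :: "nat \<Rightarrow> 'a set"
  define P where "P T = (\<Union>i<r. T i)" for T :: "nat \<Rightarrow> 'a set"
  have finB: "finite ?B" using V by simp
  have finPP: "finite PP" unfolding PP_def using finB by (intro finite_PiE) auto
  have finTT: "finite TT" unfolding TT_def using finPP by simp
  have m: "0 < m"
  proof -
    have "0 \<le> (\<Sum>Q\<in>Qs. p ^ card Q)" using p by (intro sum_nonneg) auto
    then show ?thesis using few_Qs by (cases m) auto
  qed
  have B: "T i \<subseteq> V" "card (T i) \<le> t" if "T \<in> PP" "i < r" for T i
    using that unfolding PP_def PiE_def Pi_def by auto
  \<comment> \<open>\<open>2 ^ m * (1 / 2) ^ card (S \<inter> U T)\<close> dominates the indicator of \<open>card (S \<inter> U T) \<le> m\<close>; after fewer than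
    \<open>m\<close> deletions this event is necessary for the survival of a good colouring with fingerprints \<open>T\<close>.\<close>
  define EQ where "EQ S = (\<Sum>Q\<in>Qs. if Q \<subseteq> S then 1 else 0 :: real)" for S
  define ET where "ET S = (\<Sum>T\<in>TT. if P T \<subseteq> S then (1 / 2) ^ card (S \<inter> U T) else 0 :: real)" for S
  let ?w = "rand_weight p V"
  have w0: "0 \<le> ?w S" for S using p by (simp add: rand_weight_def)
  have w1: "(\<Sum>S\<in>Pow V. ?w S) = 1" using rand_weight_supset[OF V empty_subsetI, of p] by simp
  have "(\<Sum>S\<in>Pow V. ?w S * EQ S) = (\<Sum>Q\<in>Qs. \<Sum>S\<in>Pow V. ?w S * (if Q \<subseteq> S then 1 else 0))"
    unfolding EQ_def sum_distrib_left by (rule sum.swap)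
  also have "\<dots> = (\<Sum>Q\<in>Qs. p ^ card Q)" using Qs(2) by (intro sum.cong rand_weight_supset[OF V]) auto
  finally have eq: "(\<Sum>S\<in>Pow V. ?w S * EQ S) < m / 2" using few_Qs by simp
  have "(\<Sum>S\<in>Pow V. ?w S * ET S) =
      (\<Sum>T\<in>TT. \<Sum>S\<in>Pow V. ?w S * (if P T \<subseteq> S then (1 / 2) ^ card (S \<inter> U T) else 0))"
    unfolding ET_def sum_distrib_left by (rule sum.swap)
  also have "\<dots> \<le> (\<Sum>T\<in>TT. (\<Prod>i<r. p ^ card (T i)) * (1 - p / 2) ^ u)"
  proof (rule sum_mono)
    fix T assume T: "T \<in> TT"
    then have TP: "T \<in> PP" and fT: "\<And>i. i < r \<Longrightarrow> f (T i) \<subseteq> V \<and> small (f (T i)) \<and> T i \<subseteq> f (T i)"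
      and disj: "\<And>i j. i < r \<Longrightarrow> j < r \<Longrightarrow> i \<noteq> j \<Longrightarrow> T i \<inter> T j = {}" by (auto simp: TT_def)
    have PV: "P T \<subseteq> V" using B(1)[OF TP] by (auto simp: P_def)
    \<comment> \<open>Each fingerprint lies in its own container, so the conditions on
      \<open>P T\<close> and on \<open>U T\<close> concern disjoint sets of points.\<close>
    have PU: "P T \<inter> U T = {}" using fT by (auto simp: P_def U_def)
    \<comment> \<open>Disjointness, inherited from the colour classes, splits the weight into a
      product over \<open>i\<close>.\<close>
    have "card (P T) = (\<Sum>i<r. card (T i))" unfolding P_def
      using disj finite_subset[OF B(1)[OF TP] V] by (intro card_UN_disjoint) auto
    then have pP: "p ^ card (P T) = (\<Prod>i<r. p ^ card (T i))" by (simp add: power_sum)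
    have "u \<le> card (U T)" unfolding U_def by (rule cover) (use fT in auto)
    then have "(1 - p / 2) ^ card (U T) \<le> (1 - p / 2) ^ u" using p by (intro power_decreasing) auto
    moreover have "p * (1 / 2) + (1 - p) = 1 - p / 2" by simp
    ultimately show "(\<Sum>S\<in>Pow V. ?w S * (if P T \<subseteq> S then (1 / 2) ^ card (S \<inter> U T) else 0))
        \<le> (\<Prod>i<r. p ^ card (T i)) * (1 - p / 2) ^ u"
      using rand_weight_expectation[OF V PV _ PU, of p "1 / 2"] p
      by (simp add: U_def pP[symmetric] mult_left_mono)
  qed
  also have "\<dots> = (\<Sum>T\<in>TT. (\<Prod>i<r. p ^ card (T i))) * (1 - p / 2) ^ u" by (simp add: sum_distrib_right)
  also have "\<dots> \<le> (\<Sum>T\<in>PP. (\<Prod>i<r. p ^ card (T i))) * (1 - p / 2) ^ u"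
    using p finPP by (intro mult_right_mono sum_mono2) (auto simp: TT_def intro!: prod_nonneg)
  also have "(\<Sum>T\<in>PP. (\<Prod>i<r. p ^ card (T i))) = (\<Sum>T\<in>?B. p ^ card T) ^ r"
    unfolding PP_def using prod_sum_PiE[of "{..<r}" "\<lambda>_. ?B" "\<lambda>_ T. p ^ card T"] finB by simp
  finally have et: "2 ^ m * (\<Sum>S\<in>Pow V. ?w S * ET S) \<le> 1 / 2"
    using few_colourings by (smt (verit) mult.assoc mult_left_mono zero_le_power)
  \<comment> \<open>Averaging: this sum has expectation below \<open>1 / 2 + 1 / 2\<close>. Where it
    is below 1, fewer than \<open>m\<close> members of \<open>Qs\<close> survive and no tuple in
    \<open>TT\<close> can come from a colouring.\<close>
  have "\<exists>S\<in>Pow V. EQ S / m + 2 ^ m * ET S < 1"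
  proof (rule ccontr)
    assume "\<not> ?thesis"
    then have "?w S * 1 \<le> ?w S * (EQ S / m + 2 ^ m * ET S)" if "S \<in> Pow V" for S
      using that w0 by (intro mult_left_mono) (auto simp: not_less)
    then have "(\<Sum>S\<in>Pow V. ?w S * 1) \<le> (\<Sum>S\<in>Pow V. ?w S * (EQ S / m + 2 ^ m * ET S))" by (rule sum_mono)
    also have "\<dots> = (\<Sum>S\<in>Pow V. ?w S * EQ S) / m + 2 ^ m * (\<Sum>S\<in>Pow V. ?w S * ET S)"
      by (simp add: distrib_left sum.distrib sum_divide_distrib sum_distrib_left mult_ac)
    also have "\<dots> < 1 / 2 + 1 / 2"
      using eq et m by (intro add_less_le_mono) (auto simp: field_simps)
    finally show False using w1 by simp
  qed
  then obtain S0 where S0: "S0 \<subseteq> V" "EQ S0 / m + 2 ^ m * ET S0 < 1" by blast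
  have ET0: "0 \<le> ET S0" unfolding ET_def by (intro sum_nonneg) auto
  define Q0 where "Q0 = {Q \<in> Qs. Q \<subseteq> S0}"
  have finQ0: "finite Q0" using Qs(1) by (simp add: Q0_def)
  have EQ0: "EQ S0 = card Q0"
    unfolding EQ_def Q0_def using Qs(1) by (simp add: sum.inter_filter[symmetric])
  have "EQ S0 / m < 1" using S0(2) ET0 by (smt (verit) mult_nonneg_nonneg zero_le_power)
  then have cardQ0: "card Q0 < m" using m by (simp add: EQ0)
  obtain z where z: "\<And>Q. Q \<in> Qs \<Longrightarrow> z Q \<in> Q" using Qs(2) by (metis all_not_in_conv)
  define Z where "Z = z ` Q0"
  have cardZ: "card Z < m" using card_image_le[OF finQ0, of z] cardQ0 by (simp add: Z_def)
  have finZ: "finite Z" using finQ0 by (simp add: Z_def)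
  show ?thesis
  proof (intro exI[of _ "S0 - Z"] conjI ballI notI)
    show "S0 - Z \<subseteq> V" using S0(1) by blast
  next
    fix Q assume "Q \<in> Qs" "Q \<subseteq> S0 - Z"
    then show False using z[of Q] by (auto simp: Q0_def Z_def)
  next
    assume "\<exists>c. c ` (S0 - Z) \<subseteq> {..<r} \<and> (\<forall>i<r. indep {x \<in> S0 - Z. c x = i})"
    then obtain c where c: "c ` (S0 - Z) \<subseteq> {..<r}" "\<And>i. i < r \<Longrightarrow> indep {x \<in> S0 - Z. c x = i}" by blast
    let ?I = "\<lambda>i. {x \<in> S0 - Z. c x = i}"
    have "\<forall>i\<in>{..<r}. \<exists>T. T \<subseteq> ?I i \<and> card T \<le> t \<and> ?I i \<subseteq> f T \<and> f T \<subseteq> V \<and> small (f T)"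
      using S0(1) by (intro ballI container c(2)) auto
    from bchoice[OF this] obtain T where
      "\<forall>i\<in>{..<r}. T i \<subseteq> ?I i \<and> card (T i) \<le> t \<and> ?I i \<subseteq> f (T i) \<and> f (T i) \<subseteq> V \<and> small (f (T i))" ..
    then have T: "T i \<subseteq> ?I i \<and> card (T i) \<le> t \<and> ?I i \<subseteq> f (T i) \<and> f (T i) \<subseteq> V \<and> small (f (T i))"
      if "i < r" for i using that by simp
    define T' where "T' = restrict T {..<r}"
    have T': "T' i = T i" if "i < r" for i using that by (simp add: T'_def)
    have T_mem: "x \<in> S0 - Z" "c x = i" "x \<in> f (T i)" if "i < r" "x \<in> T i" for i x
      using T[OF that(1)] that(2) by auto
    have "T i \<in> ?B" if "i < r" for i using T[OF that] T_mem[OF that] S0(1) by auto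
    then have "T' \<in> PP" unfolding PP_def T'_def by (simp add: restrict_PiE_iff)
    moreover have "T i \<inter> T j = {}" if "i < r" "j < r" "i \<noteq> j" for i j
      using T_mem(2)[OF that(1)] T_mem(2)[OF that(2)] that(3) by fastforce
    moreover have "T i \<subseteq> f (T i)" if "i < r" for i using T_mem(3)[OF that] by auto
    ultimately have T'TT: "T' \<in> TT" using T T' by (simp add: TT_def)
    have PS: "P T' \<subseteq> S0" using T_mem(1) T' by (auto simp: P_def)
    have "S0 \<inter> U T' \<subseteq> Z"
    proof
      fix x assume x: "x \<in> S0 \<inter> U T'"
      show "x \<in> Z"
      proof (rule ccontr)
        assume "x \<notin> Z"
        then have xI: "x \<in> ?I (c x)" and "c x < r" using x c(1) by auto
        have "?I (c x) \<subseteq> f (T' (c x))" unfolding T'[OF \<open>c x < r\<close>] using T[OF \<open>c x < r\<close>] by (elim conjE)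
        then have "x \<in> f (T' (c x))" using xI by (rule subsetD)
        then show False using x \<open>c x < r\<close> by (auto simp: U_def)
      qed
    qed
    then have "card (S0 \<inter> U T') \<le> card Z" by (rule card_mono[OF finZ])
    then have "card (S0 \<inter> U T') \<le> m" using cardZ by linarith
    then have "(1 / 2 :: real) ^ m \<le> (1 / 2) ^ card (S0 \<inter> U T')" by (intro power_decreasing) auto
    also have "\<dots> = (if P T' \<subseteq> S0 then (1 / 2) ^ card (S0 \<inter> U T') else 0)" using PS by simp
    also have "\<dots> \<le> ET S0" unfolding ET_def by (rule member_le_sum[OF T'TT _ finTT]) auto
    finally have "2 ^ m * (1 / 2 :: real) ^ m \<le> 2 ^ m * ET S0" by (intro mult_left_mono) auto
    then have "1 \<le> 2 ^ m * ET S0" by (simp add: power_divide)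
    moreover have "0 \<le> EQ S0 / m" by (simp add: EQ0)
    ultimately show False using S0(2) by linarith
  qed
qed

text \<open>Points are coloured by a container that covers them, uncovered points by 0. A
  monochromatic progression then lies in a container or meets an uncovered point. The containers
  account for at most half of those supplied by supersaturation, and each uncovered point for at
  most \<open>k * N\<close>.\<close>

lemma AP_cover_complement_large:
  fixes k r N W :: nat and C :: "nat \<Rightarrow> nat set"
  assumes k: "2 \<le> k" and r: "0 < r" and W: "W = vdW k r" and N: "k * W dvd N" "0 < N"
    and C: "\<And>i. i < r \<Longrightarrow> card {l \<in> AP_labels k {1..N}. AP k l \<subseteq> C i} \<le> real N ^ 2 / (4 * r * k * W ^ 3)"
  shows "N / (4 * k\<^sup>2 * W ^ 3) \<le> card ({1..N} - (\<Union>i<r. C i))"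
proof -
  define c where "c x = (if \<exists>i<r. x \<in> C i then SOME i. i < r \<and> x \<in> C i else 0)" for x
  have c: "c x < r \<and> x \<in> C (c x)" if "\<exists>i<r. x \<in> C i" for x
    using someI_ex[OF that] that by (simp add: c_def)
  have cr: "c x < r" for x using c[of x] r by (cases "\<exists>i<r. x \<in> C i") (auto simp: c_def)
  let ?U = "{1..N} - (\<Union>i<r. C i)" and ?H = "AP_labels k {1..N}"
  have finH: "finite ?H" by (rule finite_AP_labels[OF k order_refl])
  have W0: "0 < W" using colours_less_vdW[OF k r] W by simp
  let ?M = "{l \<in> ?H. monochromatic c (AP k l)}"
  have "?M \<subseteq> (\<Union>i<r. {l \<in> ?H. AP k l \<subseteq> C i}) \<union> (\<Union>x\<in>?U. {l \<in> ?H. x \<in> AP k l})"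
  proof
    fix l assume l: "l \<in> ?M"
    then obtain j where j: "\<forall>x\<in>AP k l. c x = j" by (auto simp: monochromatic_def)
    have V: "AP k l \<subseteq> {1..N}" using l by (simp add: AP_labels_def)
    show "l \<in> (\<Union>i<r. {l \<in> ?H. AP k l \<subseteq> C i}) \<union> (\<Union>x\<in>?U. {l \<in> ?H. x \<in> AP k l})"
    proof (cases "AP k l \<inter> ?U = {}")
      case True
      have "AP k l \<subseteq> C j"
      proof
        fix x assume x: "x \<in> AP k l"
        then have "\<exists>i<r. x \<in> C i" using True V by blast
        then show "x \<in> C j" using c[of x] j x by auto
      qed
      moreover have "fst l + 0 * snd l \<in> AP k l" using AP_mem[of 0 k "fst l" "snd l"] k by simp
      then have "j < r" using j cr by metis
      ultimately show ?thesis using l by blast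
    next
      case False
      then show ?thesis using l by blast
    qed
  qed
  then have "card ?M \<le> card ((\<Union>i<r. {l \<in> ?H. AP k l \<subseteq> C i}) \<union> (\<Union>x\<in>?U. {l \<in> ?H. x \<in> AP k l}))"
    using finH by (intro card_mono) auto
  also have "\<dots> \<le> card (\<Union>i<r. {l \<in> ?H. AP k l \<subseteq> C i}) + card (\<Union>x\<in>?U. {l \<in> ?H. x \<in> AP k l})"
    by (rule card_Un_le)
  also have "\<dots> \<le> (\<Sum>i<r. card {l \<in> ?H. AP k l \<subseteq> C i}) + (\<Sum>x\<in>?U. card {l \<in> ?H. x \<in> AP k l})"
    by (intro add_mono card_UN_le) auto
  finally have "real (card ?M) \<le> real ((\<Sum>i<r. card {l \<in> ?H. AP k l \<subseteq> C i}) + (\<Sum>x\<in>?U. card {l \<in> ?H. x \<in> AP k l}))"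
    by (rule of_nat_mono)
  also have "\<dots> = (\<Sum>i<r. real (card {l \<in> ?H. AP k l \<subseteq> C i})) + (\<Sum>x\<in>?U. real (card {l \<in> ?H. x \<in> AP k l}))"
    by simp
  also have "\<dots> \<le> (\<Sum>i<r. real N ^ 2 / (4 * r * k * W ^ 3)) + (\<Sum>x\<in>?U. real (k * N))"
    by (intro add_mono sum_mono) (use C AP_degree[OF k order_refl] in \<open>auto simp only: lessThan_iff of_nat_le_iff\<close>)
  also have "\<dots> = real N ^ 2 / (4 * k * W ^ 3) + card ?U * (k * N)" using r by simp
  finally have M: "real (card ?M) \<le> real N ^ 2 / (4 * k * W ^ 3) + card ?U * (k * N)" .
  have "N\<^sup>2 \<le> 2 * k * W ^ 3 * card ?M"
    using cr by (intro AP_supersaturation[OF k r W N(1)]) auto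
  then have "real (N\<^sup>2) \<le> real (2 * k * W ^ 3 * card ?M)" by (simp only: of_nat_le_iff)
  then have "real N ^ 2 \<le> (2 * k * W ^ 3) * real (card ?M)" by simp
  also have "\<dots> \<le> (2 * k * W ^ 3) * (real N ^ 2 / (4 * k * W ^ 3) + card ?U * (k * N))"
    by (rule mult_left_mono[OF M]) simp
  also have "\<dots> = real N ^ 2 / 2 + (2 * k\<^sup>2 * W ^ 3 * card ?U) * N"
    using k W0 by (simp add: field_simps power2_eq_square)
  finally have "N * real N \<le> (4 * k\<^sup>2 * W ^ 3 * card ?U) * N" by (simp add: power2_eq_square)
  then have "real N \<le> 4 * k\<^sup>2 * W ^ 3 * card ?U" using N(2) by simp
  then show ?thesis using k W0 by (simp add: field_simps)
qed

section \<open>From colourings to the chromatic number, and elementary estimates\<close>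

lemma not_properly_colourable_chromatic_number:
  assumes "\<not> (\<exists>c. proper_colouring H r c)"
  shows "enat r < chromatic_number H"
proof -
  have "enat (Suc r) \<le> chromatic_number H"
    unfolding chromatic_number_def
  proof (rule Inf_greatest)
    fix x assume "x \<in> {enat n |n. \<exists>c. proper_colouring H n c}"
    then obtain n c where x: "x = enat n" "proper_colouring H n c" by blast
    have "r < n"
    proof (rule ccontr)
      assume "\<not> r < n"
      then have "proper_colouring H r c" using x(2) by (force simp: proper_colouring_def)
      then show False using assms by blast
    qed
    then show "enat (Suc r) \<le> x" by (simp add: x)
  qed
  then show ?thesis by (metis Suc_ile_eq)
qed

lemma sum_power_below_le:
  assumes "(2 :: real) \<le> x"
  shows "(\<Sum>L<n. x ^ L) \<le> x ^ n"
proof (induction n)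
  case (Suc n)
  have "(\<Sum>L<Suc n. x ^ L) \<le> 2 * x ^ n" using Suc.IH by simp
  also have "\<dots> \<le> x ^ Suc n" using assms by simp
  finally show ?case .
qed simp

lemma sum_Un_le:
  fixes f :: "'a \<Rightarrow> real"
  assumes "finite A" "finite B" "\<And>x. 0 \<le> f x"
  shows "sum f (A \<union> B) \<le> sum f A + sum f B"
  using sum.union_inter[OF assms(1,2), of f] sum_nonneg[of "A \<inter> B" f] assms(3) by simp

lemma sum_UN_le:
  fixes f :: "'a \<Rightarrow> real"
  assumes "finite I" "\<And>i. finite (A i)" "\<And>x. 0 \<le> f x"
  shows "sum f (\<Union>i\<in>I. A i) \<le> (\<Sum>i\<in>I. sum f (A i))"
  using assms(1)
proof (induction I rule: finite_induct)
  case (insert i I)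
  have "sum f (\<Union>i\<in>insert i I. A i) \<le> sum f (A i) + sum f (\<Union>i\<in>I. A i)"
    using sum_Un_le[of "A i" "\<Union>i\<in>I. A i" f] insert.hyps assms(2,3) by simp
  also have "\<dots> \<le> sum f (A i) + (\<Sum>i\<in>I. sum f (A i))" using insert.IH by simp
  finally show ?case using insert.hyps by simp
qed simp

text \<open>Size \<open>(k - 1) * L\<close> turns the count \<open>(N * k^2) ^ L\<close> into
  \<open>(k^2 * C) ^ L\<close>, which is free of \<open>N\<close>. Pairs with two common points have
  union at least \<open>k + 1\<close>, and their expected number is a multiple of
  \<open>p * (p * N)\<close>, negligible for small \<open>p\<close>.\<close>

lemma sum_short_cycles_le:
  fixes p C :: real and k g N :: nat
  assumes p: "0 \<le> p" "p \<le> 1" and k: "1 \<le> k" and C: "N * p ^ (k - 1) = C" "2 \<le> k\<^sup>2 * C"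
  shows "(\<Sum>Q\<in>short_cycles k g {1..N}. p ^ card Q) \<le> k ^ 4 * N * p\<^sup>2 * C + (k\<^sup>2 * C) ^ g"
proof -
  let ?CS = "cycle_supports k {1..N}"
  have fin: "finite (?CS L)" and card: "card (?CS L) \<le> (N * k\<^sup>2) ^ L" for L
    using card_cycle_supports[of "{1..N}" k L] by simp_all
  have bound: "(\<Sum>Q\<in>A. p ^ card Q) \<le> real ((N * k\<^sup>2) ^ L) * q"
    if "A \<subseteq> ?CS L" "\<And>Q. Q \<in> A \<Longrightarrow> p ^ card Q \<le> q" "0 \<le> q" for A L q
  proof -
    have "(\<Sum>Q\<in>A. p ^ card Q) \<le> (\<Sum>Q\<in>A. q)" by (rule sum_mono) (rule that(2))
    also have "\<dots> = card A * q" by simp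
    also have "\<dots> \<le> real ((N * k\<^sup>2) ^ L) * q"
      using le_trans[OF card_mono[OF fin that(1)] card] that(3) by (intro mult_right_mono of_nat_mono)
    finally show ?thesis .
  qed
  let ?A = "{Q \<in> ?CS 2. k + 1 \<le> card Q}" and ?B = "\<lambda>L. {Q \<in> ?CS L. card Q = (k - 1) * L}"
  have finB: "finite (\<Union>L\<in>{3..<g}. ?B L)" using fin by simp
  have "(\<Sum>Q\<in>short_cycles k g {1..N}. p ^ card Q) \<le>
      (\<Sum>Q\<in>?A. p ^ card Q) + (\<Sum>Q\<in>(\<Union>L\<in>{3..<g}. ?B L). p ^ card Q)"
    unfolding short_cycles_def using fin finB p by (intro sum_Un_le) simp_all
  also have "(\<Sum>Q\<in>(\<Union>L\<in>{3..<g}. ?B L). p ^ card Q) \<le> (\<Sum>L\<in>{3..<g}. \<Sum>Q\<in>?B L. p ^ card Q)"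
    using fin p by (intro sum_UN_le) simp_all
  also have "(\<Sum>L\<in>{3..<g}. \<Sum>Q\<in>?B L. p ^ card Q) \<le> (\<Sum>L\<in>{3..<g}. (k\<^sup>2 * C) ^ L)"
  proof (rule sum_mono)
    fix L
    have "(\<Sum>Q\<in>?B L. p ^ card Q) \<le> real ((N * k\<^sup>2) ^ L) * p ^ ((k - 1) * L)"
      by (rule bound) (use p in auto)
    also have "\<dots> = (k\<^sup>2 * C) ^ L"
      unfolding C(1)[symmetric] by (simp only: power_mult_distrib power_mult of_nat_power of_nat_mult) (simp add: mult_ac)
    finally show "(\<Sum>Q\<in>?B L. p ^ card Q) \<le> (k\<^sup>2 * C) ^ L" .
  qed
  also have "\<dots> \<le> (\<Sum>L<g. (k\<^sup>2 * C) ^ L)" using C(2) by (intro sum_mono2) auto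
  also have "\<dots> \<le> (k\<^sup>2 * C) ^ g" by (rule sum_power_below_le[OF C(2)])
  also have "(\<Sum>Q\<in>?A. p ^ card Q) \<le> real ((N * k\<^sup>2) ^ 2) * p ^ (k + 1)"
    using p by (intro bound power_decreasing) (auto simp del: power_Suc)
  also have "\<dots> = k ^ 4 * N * p\<^sup>2 * C"
  proof -
    have "k + 1 = (k - 1) + 2" using k by simp
    then have "p ^ (k + 1) = p ^ (k - 1) * p\<^sup>2" by (metis power_add)
    then have "real ((N * k\<^sup>2) ^ 2) * p ^ (k + 1) = real ((N * k\<^sup>2) ^ 2) * (p ^ (k - 1) * p\<^sup>2)"
      by (rule arg_cong)
    then show ?thesis by (simp add: C(1)[symmetric] power2_eq_square power4_eq_xxxx mult_ac)
  qed
  finally show ?thesis by simp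
qed

lemma exp_minus_one_le_half: "exp (- (1 :: real)) \<le> 1 / 2"
proof -
  have "2 \<le> exp (1 :: real)" using exp_ge_add_one_self[of 1] by simp
  then show ?thesis by (simp add: exp_minus field_simps)
qed

lemma power_two_le_exp: "(2 :: real) ^ n \<le> exp n"
proof -
  have "(2 :: real) ^ n \<le> exp 1 ^ n" using exp_ge_add_one_self[of 1] by (intro power_mono) auto
  then show ?thesis by (simp add: exp_of_nat_mult[symmetric])
qed

text \<open>Serves as a crude bound for the logarithm of \<open>1 / y\<close> when the fingerprints
  are counted.\<close>

lemma polynomial_le_exp:
  fixes k W :: real
  assumes "3 \<le> k" "3 \<le> W"
  shows "64 * k\<^sup>2 * W ^ 4 \<le> exp (8 * k * W)"
proof -
  have "k \<le> exp k" "W \<le> exp W" using exp_ge_add_one_self[of k] exp_ge_add_one_self[of W] by linarith+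
  then have "k\<^sup>2 \<le> exp k ^ 2" "W ^ 4 \<le> exp W ^ 4" using assms by (intro power_mono; simp)+
  then have "k\<^sup>2 \<le> exp (2 * k)" "W ^ 4 \<le> exp (4 * W)"
    using exp_of_nat_mult[of 2 k] exp_of_nat_mult[of 4 W] by simp_all
  moreover have "(64 :: real) \<le> exp 6" using power_two_le_exp[of 6] by simp
  ultimately have "64 * k\<^sup>2 * W ^ 4 \<le> exp 6 * exp (2 * k) * exp (4 * W)"
    using assms by (intro mult_mono) auto
  also have "\<dots> = exp (6 + 2 * k + 4 * W)" by (simp add: exp_add)
  also have "\<dots> \<le> exp (8 * k * W)"
  proof -
    have "3 * 3 \<le> k * W" "k * 3 \<le> k * W" "3 * W \<le> k * W" using assms by (intro mult_mono; simp)+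
    moreover have "8 * k * W = 8 * (k * W)" by simp
    ultimately have "6 + 2 * k + 4 * W \<le> 8 * k * W" using assms by linarith
    then show ?thesis by simp
  qed
  finally show ?thesis .
qed

lemma divide_le_one_divide:
  fixes a b c :: real
  assumes "a * c \<le> b" "0 < b" "0 < c"
  shows "a / b \<le> 1 / c"
  using assms by (simp add: field_simps)

text \<open>The third hypothesis on \<open>p\<close> makes pairs with two common points rare, the
  fourth the longer cycles. Both are measured against \<open>p * N / (k ^ 8 * W ^ 3)\<close>, far
  below the expected number of chosen points outside \<open>r\<close> containers.\<close>

theorem sparse_AP_Ramsey:
  fixes k g r W N :: nat and p K C :: real
  assumes k: "3 \<le> k" and g: "3 \<le> g" and r: "2 \<le> r" and W: "W = vdW k r" and N: "k * W dvd N"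
    and K: "K = real k ^ (8 * k) * real W ^ 9" and C: "C = k\<^sup>2 * K ^ (k - 1)"
    and p: "0 < p" "N * p ^ (k - 1) = C" "k ^ 12 * C * W ^ 3 * p \<le> 1"
      "k ^ 8 * W ^ 3 * (k\<^sup>2 * C) ^ g \<le> p * N"
  shows "\<exists>S\<subseteq>{1..N}. enat r < chromatic_number (AP_hypergraph k S) \<and>
    girth_at_least k (AP_hypergraph k S) g"
proof -
  let ?V = "{1..N}" and ?H = "AP_labels k {1..N}"
  have rW: "r < W" using colours_less_vdW[of k r] k r W by simp
  have kr: "3 \<le> real k" and Wr: "3 \<le> real W" "1 \<le> real W" and rr: "real r \<le> real W" "1 \<le> real r"
    using k r rW by auto
  have pow_ge: "x \<le> k ^ n" if "x \<le> 3 ^ n" for x :: real and n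
    using that power_mono[of 3 "real k" n] kr by simp
  \<comment> \<open>This is \<open>8 / \<beta>\<close> with \<open>r\<close> replaced by its bound
    \<open>W\<close>.\<close>
  define e where "e = 32 * real k ^ 2 * real W ^ 4 * (8 * real k) ^ (k - 1)"
  have e0: "0 < e" using k rW by (simp add: e_def)
  \<comment> \<open>The origin of \<open>K\<close>: four of the nine powers of \<open>W\<close> come
    from \<open>e\<close>, five from the admissible fingerprint size. The factor
    \<open>k ^ 8\<close> absorbs 4096, and \<open>k ^ 3\<close> each \<open>8 * k\<close>.\<close>
  have K_big: "128 * real k ^ 4 * real W ^ 5 * e \<le> K"
  proof -
    have "(8 :: real) \<le> k ^ 2" by (rule pow_ge) simp
    then have "8 * real k \<le> k ^ 3" using kr by (simp add: power3_eq_cube power2_eq_square mult_right_mono)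
    then have "(8 * real k) ^ (k - 1) \<le> (real k ^ 3) ^ (k - 1)" by (intro power_mono) auto
    moreover have "(4096 :: real) \<le> k ^ 8" by (rule pow_ge) simp
    ultimately have "4096 * (8 * real k) ^ (k - 1) \<le> k ^ 8 * (real k ^ 3) ^ (k - 1)"
      by (intro mult_mono) auto
    then have "k ^ 6 * (4096 * (8 * real k) ^ (k - 1)) \<le> k ^ 6 * (k ^ 8 * (real k ^ 3) ^ (k - 1))"
      by (intro mult_left_mono) auto
    also have "\<dots> = real k ^ (6 + (8 + 3 * (k - 1)))" by (simp add: power_add power_mult)
    also have "\<dots> \<le> real k ^ (8 * k)" using k by (intro power_increasing) auto
    finally have "W ^ 9 * (k ^ 6 * (4096 * (8 * real k) ^ (k - 1))) \<le> W ^ 9 * real k ^ (8 * k)"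
      by (intro mult_left_mono) auto
    moreover have "128 * a * b * (32 * c * d * x) = (b * d) * ((a * c) * (4096 * x))" for a b c d x :: real
      by simp
    then have "128 * real k ^ 4 * real W ^ 5 * e =
        (real W ^ 5 * real W ^ 4) * ((real k ^ 4 * real k ^ 2) * (4096 * (8 * real k) ^ (k - 1)))"
      unfolding e_def .
    then have "128 * real k ^ 4 * real W ^ 5 * e = W ^ 9 * (k ^ 6 * (4096 * (8 * real k) ^ (k - 1)))"
      by (simp only: power_add[symmetric] of_nat_power) simp
    ultimately show ?thesis unfolding K by (simp only: mult.commute of_nat_power)
  qed
  have e1: "1 \<le> 128 * real k ^ 4 * real W ^ 5"
  proof -
    have "1 * 1 \<le> real k ^ 4 * real W ^ 5" using kr Wr by (intro mult_mono one_le_power) auto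
    then show ?thesis by simp
  qed
  have e_le_K: "e \<le> K" using mult_right_mono[OF e1, of e] e0 K_big by linarith
  have e2: "2 \<le> e"
  proof -
    have "1 * 1 * 1 \<le> real k ^ 2 * real W ^ 4 * (8 * real k) ^ (k - 1)"
      using kr Wr by (intro mult_mono one_le_power) auto
    then show ?thesis unfolding e_def by linarith
  qed
  have K0: "2 \<le> K" using e2 e_le_K by simp
  have KC: "K \<le> C"
  proof -
    have "K ^ 1 \<le> K ^ (k - 1)" using K0 k by (intro power_increasing) auto
    moreover have "1 * K ^ (k - 1) \<le> k\<^sup>2 * K ^ (k - 1)" using kr K0 by (intro mult_right_mono one_le_power) auto
    ultimately show ?thesis by (simp add: C)
  qed
  have k2C: "C \<le> k\<^sup>2 * C"
  proof -
    have "1 \<le> real (k\<^sup>2)" using one_le_power[of "real k" 2] kr by simp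
    then have "1 * C \<le> k\<^sup>2 * C" by (rule mult_right_mono) (use KC K0 in linarith)
    then show ?thesis by simp
  qed
  have big1: "1 \<le> k ^ 8 * real W ^ 3"
  proof -
    have "1 * 1 \<le> real k ^ 8 * real W ^ 3" using kr Wr by (intro mult_mono one_le_power) auto
    then show ?thesis by simp
  qed
  have pN_cycles: "(k\<^sup>2 * C) ^ g \<le> p * N / (k ^ 8 * W ^ 3)"
    using p(4) big1 by (simp add: field_simps)
  have C_le_g: "C \<le> (k\<^sup>2 * C) ^ g"
  proof -
    have "(k\<^sup>2 * C) ^ 1 \<le> (k\<^sup>2 * C) ^ g" by (rule power_increasing) (use k2C KC K0 g in linarith)+
    then show ?thesis using k2C unfolding power_one_right by linarith
  qed
  have pNK: "K \<le> p * N"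
  proof -
    have "1 * C \<le> k ^ 8 * W ^ 3 * (k\<^sup>2 * C) ^ g"
      using big1 C_le_g KC K0 by (intro mult_mono) auto
    then show ?thesis using KC p(4) by simp
  qed
  have N0: "0 < N" using pNK K0 p(1) by (cases N) auto
  have p1: "p \<le> 1"
  proof -
    have "1 * 1 * 1 \<le> k ^ 12 * C * real W ^ 3"
      using kr Wr KC K0 by (intro mult_mono one_le_power) auto
    then have "1 * p \<le> k ^ 12 * C * W ^ 3 * p" using p(1) by (intro mult_right_mono) auto
    then show ?thesis using p(3) by simp
  qed
  define \<tau> where "\<tau> = p / K"
  \<comment> \<open>Makes \<open>\<alpha> * N * (k * N)\<close> the number of progressions that
    \<open>AP_cover_complement_large\<close> allows in each container.\<close>
  define \<alpha> where "\<alpha> = 1 / (4 * r * k\<^sup>2 * real W ^ 3)"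
  define \<beta> where "\<beta> = \<alpha> / (8 * k) ^ (k - 1)"
  have \<beta>e: "8 / e \<le> \<beta>"
  proof -
    have "4 * r * k\<^sup>2 * real W ^ 3 * (8 * real k) ^ (k - 1) \<le> 4 * W * k\<^sup>2 * real W ^ 3 * (8 * real k) ^ (k - 1)"
      using rW by (intro mult_right_mono of_nat_mono mult_le_mono) auto
    also have "\<dots> = e / 8" by (simp add: e_def numeral_eq_Suc mult_ac)
    finally have "1 / (e / 8) \<le> 1 / (4 * r * k\<^sup>2 * real W ^ 3 * (8 * real k) ^ (k - 1))"
      using rr Wr kr by (intro divide_left_mono mult_pos_pos) (auto simp: e0)
    then show ?thesis by (simp add: \<beta>_def \<alpha>_def)
  qed
  have \<beta>0: "0 < \<beta>" using \<beta>e e0 by (smt (verit) divide_pos_pos)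
  have "\<exists>f. \<forall>I. I \<subseteq> ?V \<and> (\<forall>l\<in>?H. \<not> AP k l \<subseteq> I) \<longrightarrow>
    (\<exists>T\<subseteq>I. card T * \<beta> \<le> (k - 1) * (\<tau> * N + 1) \<and> I \<subseteq> f T \<and> f T \<subseteq> ?V \<and>
       card {l \<in> ?H. AP k l \<subseteq> f T} < \<alpha> * N * (k * N))"
  proof (rule containers[where \<kappa> = "k\<^sup>2"])
    show "0 < \<tau>" using p(1) K0 by (simp add: \<tau>_def)
    show "2 * \<tau> \<le> 1" using p1 K0 by (simp add: \<tau>_def field_simps)
    show "finite ?H" using k by (intro finite_AP_labels) auto
    show "AP k l \<subseteq> ?V" if "l \<in> ?H" for l using that by (simp add: AP_labels_def)
    show "card (AP k l) = k" if "l \<in> ?H" for l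
      using that card_AP[of "snd l" k "fst l"] by (simp add: AP_labels_def)
    show "card {l \<in> ?H. u \<in> AP k l \<and> w \<in> AP k l} \<le> k\<^sup>2" if "u \<noteq> w" for u w
      by (rule AP_codegree[OF that])
    show "real (deg (AP k) ?H u) \<le> real (k * N)" for u
      using AP_degree[of k ?V N u] k unfolding deg_def by (intro of_nat_mono) simp
    show "0 < \<alpha>" using rr kr Wr by (simp add: \<alpha>_def)
    show "\<beta> = \<alpha> / (8 * k) ^ (k - 1)" by (simp add: \<beta>_def)
    show "\<tau> \<le> \<beta> / 8"
    proof -
      have "\<tau> \<le> 1 / K" using p1 K0 by (simp add: \<tau>_def divide_right_mono)
      also have "\<dots> \<le> 1 / e" using e_le_K e0 by (intro divide_left_mono) auto
      finally show ?thesis using \<beta>e by simp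
    qed
    show "2 * k\<^sup>2 \<le> (2 * \<tau>) ^ (k - 1) * (k * N)"
    proof -
      \<comment> \<open>\<open>C\<close> was chosen for this: the quotient is exactly the codegree
        bound.\<close>
      have "\<tau> ^ (k - 1) * N = (N * p ^ (k - 1)) / K ^ (k - 1)"
        by (simp add: \<tau>_def power_divide mult.commute)
      then have "\<tau> ^ (k - 1) * N = C / K ^ (k - 1)" unfolding p(2) .
      also have "\<dots> = k\<^sup>2" using K0 by (simp add: C)
      finally have \<tau>N: "\<tau> ^ (k - 1) * N = k\<^sup>2" .
      have "(2 :: real) ^ 1 \<le> 2 ^ (k - 1)" using k by (intro power_increasing) auto
      then have "2 * (1 * real (k\<^sup>2)) \<le> 2 ^ (k - 1) * (k * real (k\<^sup>2))"
        using kr by (intro mult_mono mult_right_mono) auto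
      also have "\<dots> = 2 ^ (k - 1) * (k * (\<tau> ^ (k - 1) * N))" by (simp only: \<tau>N)
      finally show ?thesis by (simp add: power_mult_distrib mult_ac)
    qed
  qed (use k N0 in auto)
  then obtain f where f: "\<forall>I. I \<subseteq> ?V \<and> (\<forall>l\<in>?H. \<not> AP k l \<subseteq> I) \<longrightarrow>
    (\<exists>T\<subseteq>I. card T * \<beta> \<le> (k - 1) * (\<tau> * N + 1) \<and> I \<subseteq> f T \<and> f T \<subseteq> ?V \<and>
       card {l \<in> ?H. AP k l \<subseteq> f T} < \<alpha> * N * (k * N))" ..
  have k8: "real k ^ 8 = real k ^ 6 * real k ^ 2"
    and k12: "real k ^ 12 = real k ^ 4 * real k ^ 8" and k3: "real k ^ 3 = real k * real k ^ 2"
    and W5: "real W ^ 5 = real W * real W * real W ^ 3"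
    by (simp_all add: numeral_eq_Suc)
  \<comment> \<open>\<open>\<eta>\<close> is the proportion of points that \<open>r\<close> containers leave uncovered, and \<open>\<mu>\<close> is a quarter of the
    expected number of chosen points among these; \<open>m\<close> bounds the number of deletions.\<close>
  define \<eta> where "\<eta> = 1 / (4 * real k ^ 2 * real W ^ 3)"
  define \<mu> where "\<mu> = p * N * \<eta> / 4"
  \<comment> \<open>Chosen so that \<open>r * t * (8 * k * W) \<le> \<mu> / 4\<close>: of
    \<open>W ^ 5\<close>, one power bounds \<open>r\<close>, one belongs to the logarithm, three to
    \<open>\<eta>\<close>.\<close>
  define t where "t = nat \<lfloor>p * N / (512 * real k ^ 3 * real W ^ 5)\<rfloor>"
  define u where "u = nat \<lceil>N * \<eta>\<rceil>"
  define m where "m = nat \<lfloor>\<mu>\<rfloor>"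
  have \<eta>0: "0 < \<eta>" "\<eta> \<le> 1"
  proof -
    show "0 < \<eta>" using kr Wr by (simp add: \<eta>_def)
    have "1 * 1 \<le> real k ^ 2 * real W ^ 3" using kr Wr by (intro mult_mono one_le_power) auto
    then show "\<eta> \<le> 1" unfolding \<eta>_def by (subst divide_le_eq_1_pos) (use kr Wr in auto)
  qed
  have \<mu>_big: "45 * (p * N / (k ^ 8 * W ^ 3)) \<le> \<mu>"
  proof -
    have "(720 :: real) \<le> real k ^ 6" using pow_ge[of 720 6] by simp
    then have "720 * (p * N / (k ^ 8 * W ^ 3)) \<le> real k ^ 6 * (p * N / (k ^ 8 * W ^ 3))"
      using p(1) by (intro mult_right_mono) auto
    moreover have cancel: "A * (X / (A * B * Y)) = 16 * (X * (1 / (4 * B * Y)) / 4)" if "A \<noteq> 0" for A B X Y :: real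
      using that by simp
    have "real k ^ 6 * (p * N / (k ^ 8 * W ^ 3)) = 16 * \<mu>"
      unfolding \<mu>_def \<eta>_def of_nat_mult of_nat_power k8 by (rule cancel) (use kr in simp)
    ultimately show ?thesis by linarith
  qed
  have \<mu>2: "2 \<le> \<mu>"
  proof -
    have "2 \<le> p * N / (k ^ 8 * W ^ 3)" using K0 KC C_le_g pN_cycles by linarith
    then show ?thesis using \<mu>_big by linarith
  qed
  have m_bounds: "\<mu> - 1 < m" "m \<le> \<mu>" using \<mu>2 by (auto simp: m_def)
  have card_T: "card T \<le> t" if "card T * \<beta> \<le> (k - 1) * (\<tau> * N + 1)" for T :: "nat set"
  proof -
    have "1 \<le> \<tau> * N" using pNK K0 by (simp add: \<tau>_def)
    then have "real (k - 1) * (\<tau> * N + 1) \<le> real k * (2 * (\<tau> * N))" by (intro mult_mono) auto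
    then have "card T * (8 / e) \<le> real k * (2 * (\<tau> * N))"
      using that mult_left_mono[OF \<beta>e, of "real (card T)"] by simp
    then have "card T \<le> p * N * (k * e / (4 * K))" using e0 K0 by (simp add: \<tau>_def field_simps)
    also have "\<dots> \<le> p * N * (1 / (512 * real k ^ 3 * real W ^ 5))"
    proof (rule mult_left_mono)
      have "(k * e) * (512 * real k ^ 3 * real W ^ 5) = 4 * (128 * real k ^ 4 * real W ^ 5 * e)"
        by (simp add: numeral_eq_Suc)
      also have "\<dots> \<le> 4 * K" using K_big by linarith
      finally show "k * e / (4 * K) \<le> 1 / (512 * real k ^ 3 * real W ^ 5)"
        using K0 kr Wr by (intro divide_le_one_divide) auto
    qed (use p(1) in simp)
    finally show ?thesis unfolding t_def by (simp add: le_nat_floor)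
  qed
  have "\<exists>S\<subseteq>?V. (\<forall>Q\<in>short_cycles k g ?V. \<not> Q \<subseteq> S) \<and>
    \<not> (\<exists>c. c ` S \<subseteq> {..<r} \<and> (\<forall>i<r. \<forall>l\<in>?H. \<not> AP k l \<subseteq> {x \<in> S. c x = i}))"
  proof (rule random_subset_exists[where f = f and p = p and t = t and u = u and m = m and
        small = "\<lambda>X. card {l \<in> ?H. AP k l \<subseteq> X} < \<alpha> * N * (k * N)"])
    have "finite (cycle_supports k ?V L)" for L by (rule card_cycle_supports) simp
    then show "finite (short_cycles k g ?V)" by (simp add: short_cycles_def)
    show "Q \<subseteq> ?V \<and> Q \<noteq> {}" if "Q \<in> short_cycles k g ?V" for Q
    proof
      show "Q \<subseteq> ?V" using that unfolding short_cycles_def cycle_supports_def cyclic_chain_def by fast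
      have "0 < card Q" using that k by (auto simp: short_cycles_def)
      then show "Q \<noteq> {}" by auto
    qed
    show "\<exists>T\<subseteq>I. card T \<le> t \<and> I \<subseteq> f T \<and> f T \<subseteq> ?V \<and> card {l \<in> ?H. AP k l \<subseteq> f T} < \<alpha> * N * (k * N)"
      if "I \<subseteq> ?V" "\<forall>l\<in>?H. \<not> AP k l \<subseteq> I" for I
      using mp[OF spec[OF f] conjI[OF that]] card_T by blast
    show "u \<le> card (?V - (\<Union>i<r. C i))"
      if C: "\<And>i. i < r \<Longrightarrow> C i \<subseteq> ?V \<and> card {l \<in> ?H. AP k l \<subseteq> C i} < \<alpha> * N * (k * N)" for C
    proof -
      have "\<alpha> * N * (k * N) = real N ^ 2 / (4 * r * k * W ^ 3)"
        using kr by (simp add: \<alpha>_def power2_eq_square)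
      then have "N / (4 * k\<^sup>2 * W ^ 3) \<le> card (?V - (\<Union>i<r. C i))"
        using C k r W N N0 by (intro AP_cover_complement_large) (auto intro: less_imp_le)
      then show ?thesis unfolding u_def \<eta>_def by (simp add: ceiling_le_iff nat_le_iff)
    qed
    show "2 * (\<Sum>Q\<in>short_cycles k g ?V. p ^ card Q) < m"
    proof -
      have "(\<Sum>Q\<in>short_cycles k g ?V. p ^ card Q) \<le> k ^ 4 * N * p\<^sup>2 * C + (k\<^sup>2 * C) ^ g"
        by (rule sum_short_cycles_le[OF _ p1 _ p(2)]) (use p(1) k k2C KC K0 in linarith)+
      also have "k ^ 4 * N * p\<^sup>2 * C \<le> p * N / (k ^ 8 * W ^ 3)"
      proof -
        have "A * X * p\<^sup>2 * C = (A * B * C * Y * p) * (p * X / (B * Y))" if "B * Y \<noteq> 0" for A B X Y :: real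
          using that by (simp add: power2_eq_square)
        from this[of "real k ^ 8" "real W ^ 3" "real k ^ 4" N] kr Wr
        have "k ^ 4 * N * p\<^sup>2 * C = (k ^ 12 * C * W ^ 3 * p) * (p * N / (k ^ 8 * W ^ 3))"
          unfolding of_nat_mult of_nat_power k12 by force
        also have "\<dots> \<le> 1 * (p * N / (k ^ 8 * W ^ 3))" using p by (intro mult_right_mono) auto
        finally show ?thesis by simp
      qed
      finally show ?thesis using pN_cycles \<mu>_big \<mu>2 m_bounds by linarith
    qed
    show "2 ^ m * (\<Sum>T | T \<subseteq> ?V \<and> card T \<le> t. p ^ card T) ^ r * (1 - p / 2) ^ u \<le> 1 / 2"
    proof -
      \<comment> \<open>Makes \<open>r * (p * y * N)\<close> equal to
        \<open>\<mu> / 4\<close>.\<close>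
      define y where "y = \<eta> / (16 * r)"
      have y: "0 < y" "y \<le> 1" using \<eta>0 rr by (auto simp: y_def divide_le_eq)
      have "1 / y = 64 * real r * real k ^ 2 * real W ^ 3" using rr kr Wr by (simp add: y_def \<eta>_def)
      also have "\<dots> \<le> 64 * real W * real k ^ 2 * real W ^ 3" using rr by (intro mult_right_mono) auto
      also have "\<dots> = 64 * real k ^ 2 * real W ^ 4" by (simp add: numeral_eq_Suc)
      also have "\<dots> \<le> exp (8 * real k * real W)" by (rule polynomial_le_exp[OF kr Wr(1)])
      finally have "(1 / y) ^ t \<le> exp (8 * real k * real W) ^ t" using y by (intro power_mono) auto
      also have "\<dots> = exp (t * (8 * real k * real W))" by (simp add: exp_of_nat_mult)
      finally have yt: "(1 / y) ^ t \<le> exp (t * (8 * real k * real W))" .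
      have "(\<Sum>T | T \<subseteq> ?V \<and> card T \<le> t. p ^ card T) \<le> (1 / y) ^ t * exp (p * y * card ?V)"
        by (rule sum_small_subsets_le) (use p(1) y in auto)
      also have "\<dots> \<le> exp (t * (8 * real k * real W)) * exp (p * y * N)" using yt by simp
      also have "\<dots> = exp (t * (8 * real k * real W) + p * y * N)" by (simp add: exp_add)
      finally have "(\<Sum>T | T \<subseteq> ?V \<and> card T \<le> t. p ^ card T) ^ r \<le> exp (t * (8 * real k * real W) + p * y * N) ^ r"
        using p(1) by (intro power_mono sum_nonneg) auto
      also have "\<dots> = exp (r * (t * (8 * real k * real W)) + r * (p * y * N))"
        by (simp add: exp_of_nat_mult[symmetric] distrib_left)
      also have "\<dots> \<le> exp (\<mu> / 4 + \<mu> / 4)"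
      proof -
        have "real t \<le> p * N / (512 * real k ^ 3 * real W ^ 5)" using p(1) by (simp add: t_def)
        then have "r * (t * (8 * real k * real W)) \<le> W * (p * N / (512 * real k ^ 3 * real W ^ 5) * (8 * real k * real W))"
          using rr p(1) by (intro mult_mono mult_right_mono) auto
        also have "\<dots> = \<mu> / 4"
        proof -
          have "w * (X / (512 * (a * b) * (w * w * Y)) * (8 * a * w)) = X * (1 / (4 * b * Y)) / 4 / 4"
            if "a \<noteq> 0" "w \<noteq> 0" for a b w X Y :: real using that by simp
          from this[of "real k" "real W" "p * N" "real k ^ 2" "real W ^ 3"] kr Wr
          show ?thesis unfolding \<mu>_def \<eta>_def k3 W5 by force
        qed
        finally have "r * (t * (8 * real k * real W)) \<le> \<mu> / 4" .
        moreover have "r * (p * y * N) = \<mu> / 4" using rr by (simp add: y_def \<mu>_def)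
        ultimately show ?thesis by simp
      qed
      finally have A: "(\<Sum>T | T \<subseteq> ?V \<and> card T \<le> t. p ^ card T) ^ r \<le> exp (\<mu> / 2)" by simp
      have "(1 - p / 2) ^ u \<le> exp (- (p / 2)) ^ u"
        using p1 exp_ge_add_one_self[of "- (p / 2)"] by (intro power_mono) auto
      also have "\<dots> = exp (- (p * u / 2))" by (simp add: exp_of_nat_mult[symmetric] mult_ac)
      also have "\<dots> \<le> exp (- 2 * \<mu>)"
      proof -
        have "N * \<eta> \<le> u" unfolding u_def by (rule real_nat_ceiling_ge)
        then have "p * (N * \<eta>) \<le> p * u" using p(1) by (intro mult_left_mono) auto
        then show ?thesis unfolding \<mu>_def exp_le_cancel_iff by linarith
      qed
      finally have B: "(1 - p / 2) ^ u \<le> exp (- 2 * \<mu>)" .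
      have "(2 :: real) ^ m \<le> exp \<mu>" using power_two_le_exp[of m] m_bounds(2) by (smt (verit) exp_le_cancel_iff)
      \<comment> \<open>The balance of exponents: \<open>\<mu>\<close> for the deletions,
        \<open>\<mu> / 2\<close> for the fingerprints, \<open>- 2 * \<mu>\<close> for the missing
        points.\<close>
      then have "2 ^ m * (\<Sum>T | T \<subseteq> ?V \<and> card T \<le> t. p ^ card T) ^ r * (1 - p / 2) ^ u
          \<le> exp \<mu> * exp (\<mu> / 2) * exp (- 2 * \<mu>)"
        using A B p1 p(1) by (intro mult_mono) (auto intro!: sum_nonneg zero_le_power mult_nonneg_nonneg)
      also have "\<dots> = exp (- \<mu> / 2)" by (simp add: exp_add[symmetric])
      also have "\<dots> \<le> exp (- 1)" using \<mu>2 by simp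
      finally show ?thesis using exp_minus_one_le_half by simp
    qed
  qed (use p(1) p1 in auto)
  then obtain S where S: "S \<subseteq> ?V" "\<forall>Q\<in>short_cycles k g ?V. \<not> Q \<subseteq> S"
    and col: "\<not> (\<exists>c. c ` S \<subseteq> {..<r} \<and> (\<forall>i<r. \<forall>l\<in>?H. \<not> AP k l \<subseteq> {x \<in> S. c x = i}))"
    by (elim exE conjE) (rule that)
  have "\<not> (\<exists>c. proper_colouring (AP_hypergraph k S) r c)"
  proof
    assume "\<exists>c. proper_colouring (AP_hypergraph k S) r c"
    then obtain c where c: "c ` S \<subseteq> {..<r}" "\<And>e. e \<subseteq> S \<Longrightarrow> is_AP k e \<Longrightarrow> \<not> monochromatic c e"
      by (auto simp: proper_colouring_def AP_hypergraph_def)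
    from col c(1) have "\<not> (\<forall>i<r. \<forall>l\<in>?H. \<not> AP k l \<subseteq> {x \<in> S. c x = i})" by fast
    then obtain i l where l: "l \<in> ?H" "AP k l \<subseteq> {x \<in> S. c x = i}" by fast
    have "is_AP k (AP k l)" using l(1) unfolding is_AP_iff AP_labels_def
      by (intro exI[of _ "fst l"] exI[of _ "snd l"]) simp
    moreover have "AP k l \<subseteq> S" using l(2) by blast
    moreover have "monochromatic c (AP k l)" using l(2) unfolding monochromatic_def by blast
    ultimately show False using c(2) by blast
  qed
  then have "enat r < chromatic_number (AP_hypergraph k S)" by (rule not_properly_colourable_chromatic_number)
  moreover have "girth_at_least k (AP_hypergraph k S) g"
    using k by (intro girth_at_least_AP[OF _ S(1) S(2)[rule_format]]) auto
  ultimately show ?thesis using S(1) by blast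
qed

text \<open>With \<open>C = k ^ a * W ^ b\<close> and \<open>N = k ^ A * W ^ B\<close>, the two
  conditions on \<open>p\<close>, raised to the power \<open>n\<close>, become comparisons of
  exponents of \<open>k\<close> and \<open>W\<close>. For \<open>k = 3\<close> the coefficient of
  \<open>g\<close> is 36 on both sides of the last inequality; there the 12 in \<open>B\<close> is
  sharp.\<close>

lemma exponent_bounds:
  fixes k g n a b A B :: nat
  assumes k: "3 \<le> k" and n: "n = k - 1" and a: "a = 2 + 8 * k * n" and b: "b = 9 * n"
    and A: "A = 40 * k\<^sup>2 * (k + g)" and B: "B = 12 * k * (k + g)"
  shows "(12 + a) * n + a \<le> A" "(3 + b) * n + b \<le> B"
    and "(8 + (2 + a) * g) * n \<le> a + A * (n - 1)" "(3 + b * g) * n \<le> b + B * (n - 1)"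
proof -
  \<comment> \<open>This substitution removes the subtractions, leaving polynomials in
    \<open>j\<close> and \<open>g\<close>.\<close>
  obtain j where j: "k = j + 3" using k by (metis add.commute le_Suc_ex)
  show "(12 + a) * n + a \<le> A" "(3 + b) * n + b \<le> B"
    and "(8 + (2 + a) * g) * n \<le> a + A * (n - 1)" "(3 + b * g) * n \<le> b + B * (n - 1)"
    unfolding A B a b n j by (simp_all add: algebra_simps power2_eq_square)
qed

lemma two_powers_mult: "(k ^ a * W ^ b) * (k ^ c * W ^ d) = k ^ (a + c) * W ^ (b + d)"
  for k W :: nat
  by (simp add: power_add)

lemma two_powers_power: "(k ^ a * W ^ b) ^ n = k ^ (a * n) * W ^ (b * n)"
  for k W :: nat
  by (simp add: power_mult_distrib power_mult)

lemma mult_power_mono: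
  fixes k W :: nat
  assumes "1 \<le> k" "1 \<le> W" "a \<le> c" "b \<le> d"
  shows "k ^ a * W ^ b \<le> k ^ c * W ^ d"
  using assms by (auto intro!: mult_le_mono power_increasing)

theorem theorem1p3:
  fixes k g r :: nat
  assumes "k \<ge> 3" and "g \<ge> 3" and "r \<ge> 2"
  shows "\<exists>S :: nat set. finite S \<and>
           chromatic_number (AP_hypergraph k S) > enat r \<and>
           girth_at_least k (AP_hypergraph k S) g \<and>
           card S \<le> k ^ (40 * k\<^sup>2 * (k + g)) * vdW k r ^ (12 * k * (k + g))"
proof -
  define W n a b A B where "W = vdW k r" and "n = k - 1" and "a = 2 + 8 * k * n" and "b = 9 * n"
    and "A = 40 * k\<^sup>2 * (k + g)" and "B = 12 * k * (k + g)"
  note exponents = exponent_bounds[OF assms(1) \<open>n = k - 1\<close> \<open>a = 2 + 8 * k * n\<close> \<open>b = 9 * n\<close>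
      \<open>A = 40 * k\<^sup>2 * (k + g)\<close> \<open>B = 12 * k * (k + g)\<close>]
  define N c where "N = k ^ A * W ^ B" and "c = k ^ a * W ^ b"
  have W: "1 \<le> W" using colours_less_vdW[of k r] assms by (simp add: W_def)
  have n: "0 < n" "n = Suc (n - 1)" using assms(1) by (auto simp: n_def)
  have pos: "0 < N" "0 < c" using assms(1) W by (auto simp: N_def c_def)
  \<comment> \<open>The solution of \<open>N * p ^ n = c\<close>; the conditions on \<open>p\<close>
    are checked after raising to the power \<open>n\<close>, which removes the root.\<close>
  define p where "p = root n (real c / real N)"
  have p0: "0 < p" using n pos by (simp add: p_def)
  have pn: "p ^ n = c / N" using n pos by (simp add: p_def real_root_pow_pos2)
  have "c = k\<^sup>2 * (k ^ (8 * k) * W ^ 9) ^ (k - 1)"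
    unfolding two_powers_power by (simp only: c_def a_def b_def n_def power_add mult.assoc)
  then have c_eq: "real c = k\<^sup>2 * (real k ^ (8 * k) * real W ^ 9) ^ (k - 1)" by simp
  have dense: "(k ^ 12 * c * W ^ 3) ^ n * c \<le> N"
  proof -
    have "(k ^ 12 * c * W ^ 3) ^ n * c = k ^ ((12 + a) * n + a) * W ^ ((3 + b) * n + b)"
    proof -
      have "k ^ 12 * c * W ^ 3 = (k ^ 12 * W ^ 3) * (k ^ a * W ^ b)" by (simp add: c_def)
      then show ?thesis by (simp only: c_def two_powers_mult two_powers_power)
    qed
    also have "\<dots> \<le> N" unfolding N_def using assms(1) W exponents(1,2) by (intro mult_power_mono) auto
    finally show ?thesis .
  qed
  have large: "(k ^ 8 * W ^ 3 * (k\<^sup>2 * c) ^ g) ^ n \<le> c * N ^ (n - 1)"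
  proof -
    have "(k ^ 8 * W ^ 3 * (k\<^sup>2 * c) ^ g) ^ n = k ^ ((8 + (2 + a) * g) * n) * W ^ ((3 + b * g) * n)"
    proof -
      have "k\<^sup>2 * c = k ^ (2 + a) * W ^ b" by (simp add: c_def power_add power2_eq_square)
      then show ?thesis by (simp only: two_powers_mult two_powers_power)
    qed
    also have "\<dots> \<le> k ^ (a + A * (n - 1)) * W ^ (b + B * (n - 1))"
      using assms(1) W exponents(3,4) by (intro mult_power_mono) auto
    also have "\<dots> = c * N ^ (n - 1)"
      unfolding c_def N_def by (simp only: two_powers_mult two_powers_power)
    finally show ?thesis .
  qed
  have "k * W dvd N"
  proof -
    have "0 < A" "0 < B" using assms(1) by (auto simp: A_def B_def)
    then show ?thesis unfolding N_def by (intro mult_dvd_mono dvd_power) auto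
  qed
  moreover have "N * p ^ (k - 1) = c" using pn pos by (simp add: n_def)
  moreover have "k ^ 12 * real c * W ^ 3 * p \<le> 1"
  proof -
    have "(k ^ 12 * c * W ^ 3 * p) ^ n = real ((k ^ 12 * c * W ^ 3) ^ n * c) / N"
      by (simp add: power_mult_distrib pn)
    also have "\<dots> \<le> 1" using of_nat_mono[OF dense, where 'a = real] pos by simp
    finally show ?thesis using n p0 by (simp add: power_le_one_iff)
  qed
  moreover have "k ^ 8 * W ^ 3 * (k\<^sup>2 * real c) ^ g \<le> p * N"
  proof (rule power_le_imp_le_base)
    have "(k ^ 8 * W ^ 3 * (k\<^sup>2 * real c) ^ g) ^ Suc (n - 1) = real ((k ^ 8 * W ^ 3 * (k\<^sup>2 * c) ^ g) ^ n)"
      using n by simp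
    also have "\<dots> \<le> real (c * N ^ (n - 1))" using large by (rule of_nat_mono)
    also have "\<dots> = (p * N) ^ n"
    proof -
      have "(p * N) ^ n = c / N * real N ^ Suc (n - 1)" using n(2) by (simp add: power_mult_distrib pn)
      then show ?thesis using pos by simp
    qed
    finally show "(k ^ 8 * W ^ 3 * (k\<^sup>2 * real c) ^ g) ^ Suc (n - 1) \<le> (p * N) ^ Suc (n - 1)"
      using n(2) by simp
  qed (use p0 in simp)
  ultimately have "\<exists>S\<subseteq>{1..N}. enat r < chromatic_number (AP_hypergraph k S) \<and>
      girth_at_least k (AP_hypergraph k S) g"
    by (rule sparse_AP_Ramsey[OF assms W_def _ refl c_eq p0])
  then obtain S where S: "S \<subseteq> {1..N}" "enat r < chromatic_number (AP_hypergraph k S)"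
      "girth_at_least k (AP_hypergraph k S) g" by blast
  moreover have "card S \<le> N" using card_mono[OF _ S(1)] by simp
  moreover have "finite S" using S(1) by (rule finite_subset) simp
  ultimately show ?thesis unfolding N_def W_def A_def B_def by blast
qed

end
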